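(* Let $R$ be a ring with unity and let $\mathcal{X}$ be a semibrick of left $R$-modules such that every $X\in\mathcal{X}$ has projective dimension at most one and $\mathcal{X}$ contains no $\mathcal{X}$-divisible objects. Then the $\mathcal{X}$-socle filtration of every module $M\in\mathrm{Filt}(\mathcal{X})$ has finite or countable length.
   Context: A brick is a finitely presented left $R$-module whose endomorphism ring is a division ring. A semibrick is a class $\mathcal{X}$ of pairwise non-isomorphic bricks with $\mathrm{Hom}(X,X')=0$ for distinct $X,X'\in\mathcal{X}$. A module $M$ is $\mathcal{X}$-divisible if $\mathrm{Ext}^1(X,M)=0$ for all $X\in\mathcal{X}$. A filtration of a module $M$ is an ascending chain $(M_\lambda,\lambda\le\mu)$ of submodules ($\mu$ an ordinal) with $M_0=0$, $M_\mu=M$ and $M_\nu=\bigcup_{\lambda<\nu}M_\lambda$ for limit ordinals $\nu\le\mu$. It is an $\mathcal{X}$-filtration if each $M_{\lambda+1}/M_\lambda$ ($\lambda<\mu$) is isomorphic to a module in $\mathcal{X}$. $\mathrm{Filt}(\mathcal{X})$ is the class of modules admitting an $\mathcal{X}$-filtration. For a module $N$ put $\mathrm{soc}_{\mathcal{X}}N=\sum_{X\in\mathcal{X},\,f\in\mathrm{Hom}(X,N)}\mathrm{Im}\,f$. The $\mathcal{X}$-socle filtration $(V_\lambda,\lambda\le\mu)$ of $M\in\mathrm{Filt}(\mathcal{X})$ is defined inductively by $V_0=0$, $V_{\lambda+1}$ the preimage of $\mathrm{soc}_{\mathcal{X}}(M/V_\lambda)$ under $M\to M/V_\lambda$, and $V_\lambda=\bigcup_{\alpha<\lambda}V_\alpha$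 for limit ordinals $\lambda$; its length is the least ordinal $\mu$ with $V_\mu=M$. *)

theory Defs
  imports "HOL-Algebra.Module" "HOL-Algebra.AbelCoset" "HOL-Algebra.Elementary_Groups" "HOL-Library.Countable_Set"
begin

section \<open>Left modules over a ring that need not be commutative\<close>

text \<open>
  The library locale \<^locale>\<open>module\<close> requires a commutative ring of scalars.  We keep its
  record type, whose fields \<^const>\<open>monoid.mult\<close> and \<^const>\<open>monoid.one\<close> are ignored, and its notion of
  \<^locale>\<open>submodule\<close>, which does not depend on commutativity.
\<close>

locale left_module = R?: ring R + M?: abelian_group M
  for R :: "('r, 'k) ring_scheme" (structure) and M :: "('r, 'm) module" (structure) +
  assumes smult_closed [simp, intro]:
      "\<lbrakk>a \<in> carrier R; x \<in> carrier M\<rbrakk> \<Longrightarrow> a \<odot>\<^bsub>M\<^esub> x \<in> carrier M"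
    and smult_l_distr:
      "\<lbrakk>a \<in> carrier R; b \<in> carrier R; x \<in> carrier M\<rbrakk> \<Longrightarrow>
        (a \<oplus> b) \<odot>\<^bsub>M\<^esub> x = a \<odot>\<^bsub>M\<^esub> x \<oplus>\<^bsub>M\<^esub> b \<odot>\<^bsub>M\<^esub> x"
    and smult_r_distr:
      "\<lbrakk>a \<in> carrier R; x \<in> carrier M; y \<in> carrier M\<rbrakk> \<Longrightarrow>
        a \<odot>\<^bsub>M\<^esub> (x \<oplus>\<^bsub>M\<^esub> y) = a \<odot>\<^bsub>M\<^esub> x \<oplus>\<^bsub>M\<^esub> a \<odot>\<^bsub>M\<^esub> y"
    and smult_assoc1:
      "\<lbrakk>a \<in> carrier R; b \<in> carrier R; x \<in> carrier M\<rbrakk> \<Longrightarrow>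
        (a \<otimes> b) \<odot>\<^bsub>M\<^esub> x = a \<odot>\<^bsub>M\<^esub> (b \<odot>\<^bsub>M\<^esub> x)"
    and smult_one [simp]:
      "x \<in> carrier M \<Longrightarrow> \<one> \<odot>\<^bsub>M\<^esub> x = x"

text \<open>Homomorphisms are extensional functions, so that a homomorphism is determined by its
  values on the carrier.\<close>

definition Hom :: "('r, 'k) ring_scheme \<Rightarrow> ('r, 'm) module \<Rightarrow> ('r, 'n) module \<Rightarrow> ('m \<Rightarrow> 'n) set"
  where "Hom R M N = {f \<in> carrier M \<rightarrow>\<^sub>E carrier N.
    (\<forall>x\<in>carrier M. \<forall>y\<in>carrier M. f (x \<oplus>\<^bsub>M\<^esub> y) = f x \<oplus>\<^bsub>N\<^esub> f y) \<and>
    (\<forall>a\<in>carrier R. \<forall>x\<in>carrier M. f (a \<odot>\<^bsub>M\<^esub> x) = a \<odot>\<^bsub>N\<^esub> f x)}"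

definition zero_map :: "('r, 'm) module \<Rightarrow> ('r, 'n) module \<Rightarrow> 'm \<Rightarrow> 'n"
  where "zero_map M N = (\<lambda>x\<in>carrier M. \<zero>\<^bsub>N\<^esub>)"

definition ker :: "('r, 'm) module \<Rightarrow> ('r, 'n) module \<Rightarrow> ('m \<Rightarrow> 'n) \<Rightarrow> 'm set"
  where "ker M N f = {x \<in> carrier M. f x = \<zero>\<^bsub>N\<^esub>}"

definition module_iso :: "('r, 'k) ring_scheme \<Rightarrow> ('r, 'm) module \<Rightarrow> ('r, 'n) module \<Rightarrow> bool"
  where "module_iso R M N \<longleftrightarrow> (\<exists>f \<in> Hom R M N. bij_betw f (carrier M) (carrier N))"

definition restrict_module :: "('r, 'm) module \<Rightarrow> 'm set \<Rightarrow> ('r, 'm) module"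
  where "restrict_module M H = M\<lparr>carrier := H\<rparr>"

definition quot_module :: "('r, 'm) module \<Rightarrow> 'm set \<Rightarrow> ('r, 'm set) module"
  where "quot_module M H =
    \<lparr>carrier = a_rcosets\<^bsub>M\<^esub> H, monoid.mult = (\<lambda>_ _. H), one = H, ring.zero = H, ring.add = set_add M,
     smult = (\<lambda>a C. \<Union>x\<in>C. H +>\<^bsub>M\<^esub> (a \<odot>\<^bsub>M\<^esub> x))\<rparr>"

text \<open>The free module \<open>R\<^sup>(\<^sup>I\<^sup>)\<close> on a set \<open>I\<close> of basis elements.\<close>

definition free_module :: "('r, 'k) ring_scheme \<Rightarrow> 'i set \<Rightarrow> ('r, 'i \<Rightarrow> 'r) module"
  where "free_module R I =
    \<lparr>carrier = {x \<in> I \<rightarrow>\<^sub>E carrier R. finite {i \<in> I. x i \<noteq> \<zero>\<^bsub>R\<^esub>}},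
     monoid.mult = (\<lambda>_ _. \<lambda>i\<in>I. \<zero>\<^bsub>R\<^esub>), one = (\<lambda>i\<in>I. \<zero>\<^bsub>R\<^esub>), ring.zero = (\<lambda>i\<in>I. \<zero>\<^bsub>R\<^esub>),
     ring.add = (\<lambda>x y. \<lambda>i\<in>I. x i \<oplus>\<^bsub>R\<^esub> y i), smult = (\<lambda>a x. \<lambda>i\<in>I. a \<otimes>\<^bsub>R\<^esub> x i)\<rparr>"

definition free_lift ::
    "('r, 'k) ring_scheme \<Rightarrow> 'i set \<Rightarrow> ('r, 'm) module \<Rightarrow> ('i \<Rightarrow> 'm) \<Rightarrow> ('i \<Rightarrow> 'r) \<Rightarrow> 'm"
  where "free_lift R I M \<phi> = (\<lambda>x\<in>carrier (free_module R I).
    \<Oplus>\<^bsub>M\<^esub>i\<in>{i \<in> I. x i \<noteq> \<zero>\<^bsub>R\<^esub>}. x i \<odot>\<^bsub>M\<^esub> \<phi> i)"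


section \<open>Semibricks\<close>

definition finitely_presented :: "('r, 'k) ring_scheme \<Rightarrow> ('r, 'm) module \<Rightarrow> bool"
  where "finitely_presented R M \<longleftrightarrow>
    (\<exists>(m::nat) (n::nat).
      \<exists>d \<in> Hom R (free_module R {..<m}) (free_module R {..<n}).
      \<exists>p \<in> Hom R (free_module R {..<n}) M.
        d ` carrier (free_module R {..<m}) = ker (free_module R {..<n}) M p \<and>
        p ` carrier (free_module R {..<n}) = carrier M)"

definition End_ring :: "('r, 'k) ring_scheme \<Rightarrow> ('r, 'm) module \<Rightarrow> ('m \<Rightarrow> 'm) ring"
  where "End_ring R M =
    \<lparr>carrier = Hom R M M, monoid.mult = compose (carrier M), one = (\<lambda>x\<in>carrier M. x),
     ring.zero = zero_map M M, ring.add = (\<lambda>f g. \<lambda>x\<in>carrier M. f x \<oplus>\<^bsub>M\<^esub> g x)\<rparr>"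

definition division_ring :: "('a, 'k) ring_scheme \<Rightarrow> bool"
  where "division_ring D \<longleftrightarrow> ring D \<and> Units D = carrier D - {\<zero>\<^bsub>D\<^esub>}"

definition brick :: "('r, 'k) ring_scheme \<Rightarrow> ('r, 'm) module \<Rightarrow> bool"
  where "brick R M \<longleftrightarrow>
    left_module R M \<and> finitely_presented R M \<and> division_ring (End_ring R M)"

text \<open>
  Finitely presented modules form a set up to isomorphism, so a semibrick is a set of modules whose
  carriers live in a common type.
\<close>

definition semibrick :: "('r, 'k) ring_scheme \<Rightarrow> ('r, 'x) module set \<Rightarrow> bool"
  where "semibrick R \<S> \<longleftrightarrow>
    (\<forall>B\<in>\<S>. brick R B) \<and>
    (\<forall>B\<in>\<S>. \<forall>C\<in>\<S>. B \<noteq> C \<longrightarrow> \<not> module_iso R B C \<and> Hom R B C = {zero_map B C})"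


section \<open>Projective dimension and \<open>Ext\<^sup>1\<close>\<close>

text \<open>
  A constant cannot quantify over types, so the carriers of the test modules are bounded: they
  live in the type of the free module on the carrier of \<open>P\<close> and in the type of \<open>P\<close>.  This is no
  restriction, see \<open>projective_lift\<close> below.
\<close>

definition projective :: "('r, 'k) ring_scheme \<Rightarrow> ('r, 'p) module \<Rightarrow> bool"
  where "projective R P \<longleftrightarrow> left_module R P \<and>
    (\<forall>(A :: ('r, 'p \<Rightarrow> 'r) module) (B :: ('r, 'p) module).
      \<forall>g \<in> Hom R A B. \<forall>f \<in> Hom R P B.
        left_module R A \<longrightarrow> left_module R B \<longrightarrow> g ` carrier A = carrier B \<longrightarrow>
          (\<exists>h \<in> Hom R P A. compose (carrier P) g h = f))"

text \<open>
  There is an exact sequence \<open>0 \<rightarrow> P\<^sub>1 \<rightarrow> P\<^sub>0 \<rightarrow> M \<rightarrow> 0\<close> with \<open>P\<^sub>0\<close> and \<open>P\<^sub>1\<close> projective.  By Schanuel's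
  lemma it may be taken inside the type of the free module on the carrier of \<open>M\<close>,
  see \<open>proj_dim_le_1I\<close> below.
\<close>

definition proj_dim_le_1 :: "('r, 'k) ring_scheme \<Rightarrow> ('r, 'm) module \<Rightarrow> bool"
  where "proj_dim_le_1 R M \<longleftrightarrow>
    (\<exists>(P\<^sub>0 :: ('r, 'm \<Rightarrow> 'r) module) (P\<^sub>1 :: ('r, 'm \<Rightarrow> 'r) module).
      projective R P\<^sub>0 \<and> projective R P\<^sub>1 \<and>
      (\<exists>d \<in> Hom R P\<^sub>1 P\<^sub>0. \<exists>p \<in> Hom R P\<^sub>0 M.
        inj_on d (carrier P\<^sub>1) \<and> d ` carrier P\<^sub>1 = ker P\<^sub>0 M p \<and>
        p ` carrier P\<^sub>0 = carrier M))"

text \<open>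
  The standard free resolution \<open>\<dots> \<rightarrow> P\<^sub>2 \<rightarrow> P\<^sub>1 \<rightarrow> P\<^sub>0 \<rightarrow> M \<rightarrow> 0\<close> has \<open>P\<^sub>0\<close>, \<open>P\<^sub>1\<close>, \<open>P\<^sub>2\<close> free on the carriers of
  \<open>M\<close>, of its syzygy \<open>Ker (P\<^sub>0 \<rightarrow> M)\<close>, and of the syzygy of the latter.
  \<open>Ext\<^sup>1(M, N)\<close> is the first cohomology group of \<open>Hom(P\<^sub>\<bullet>, N)\<close>.
\<close>

definition cover :: "('r, 'k) ring_scheme \<Rightarrow> ('r, 'm) module \<Rightarrow> ('m \<Rightarrow> 'r) \<Rightarrow> 'm"
  where "cover R M = free_lift R (carrier M) M (\<lambda>x. x)"

definition syzygy :: "('r, 'k) ring_scheme \<Rightarrow> ('r, 'm) module \<Rightarrow> ('r, 'm \<Rightarrow> 'r) module"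
  where "syzygy R M = restrict_module (free_module R (carrier M))
    (ker (free_module R (carrier M)) M (cover R M))"

definition Hom_group ::
    "('r, 'k) ring_scheme \<Rightarrow> ('r, 'm) module \<Rightarrow> ('r, 'n) module \<Rightarrow> ('m \<Rightarrow> 'n) monoid"
  where "Hom_group R M N =
    \<lparr>carrier = Hom R M N, monoid.mult = (\<lambda>f g. \<lambda>x\<in>carrier M. f x \<oplus>\<^bsub>N\<^esub> g x), one = zero_map M N\<rparr>"

definition Ext1 :: "('r, 'k) ring_scheme \<Rightarrow> ('r, 'm) module \<Rightarrow> ('r, 'n) module \<Rightarrow>
    ((('m \<Rightarrow> 'r) \<Rightarrow> 'r) \<Rightarrow> 'n) set monoid"
  where "Ext1 R M N =
    (let P\<^sub>0 = free_module R (carrier M);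
         P\<^sub>1 = free_module R (carrier (syzygy R M));
         P\<^sub>2 = free_module R (carrier (syzygy R (syzygy R M)));
         d\<^sub>1 = cover R (syzygy R M);
         d\<^sub>2 = cover R (syzygy R (syzygy R M));
         Z = {f \<in> Hom R P\<^sub>1 N. compose (carrier P\<^sub>2) f d\<^sub>2 = zero_map P\<^sub>2 N};
         B = {compose (carrier P\<^sub>1) g d\<^sub>1 | g. g \<in> Hom R P\<^sub>0 N}
     in (Hom_group R P\<^sub>1 N)\<lparr>carrier := Z\<rparr> Mod B)"

definition divisible ::
    "('r, 'k) ring_scheme \<Rightarrow> ('r, 'x) module set \<Rightarrow> ('r, 'm) module \<Rightarrow> bool"
  where "divisible R \<S> M \<longleftrightarrow> (\<forall>B\<in>\<S>. trivial_group (Ext1 R B M))"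


section \<open>Filtrations\<close>

text \<open>
  Ordinals are the elements of an arbitrary type \<open>'o\<close> of class \<^class>\<open>wellorder\<close>; an element \<open>\<mu>\<close>
  stands for the order type of \<open>{..<\<mu>}\<close>.  Such a type may have a greatest element.
\<close>

definition is_zero :: "'o::wellorder \<Rightarrow> bool"
  where "is_zero \<gamma> \<longleftrightarrow> (\<forall>\<kappa>. \<gamma> \<le> \<kappa>)"

definition is_succ :: "'o::wellorder \<Rightarrow> 'o \<Rightarrow> bool"
  where "is_succ \<kappa> \<gamma> \<longleftrightarrow> \<kappa> < \<gamma> \<and> (\<forall>\<alpha>. \<kappa> < \<alpha> \<longrightarrow> \<gamma> \<le> \<alpha>)"

definition is_limit :: "'o::wellorder \<Rightarrow> bool"
  where "is_limit \<gamma> \<longleftrightarrow> \<not> is_zero \<gamma> \<and> (\<nexists>\<kappa>. is_succ \<kappa> \<gamma>)"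

lemma is_succ_unique: "is_succ \<kappa> \<gamma> \<Longrightarrow> is_succ \<kappa>' \<gamma> \<Longrightarrow> \<kappa> = \<kappa>'"
  unfolding is_succ_def by (metis leD linorder_neqE)

lemma is_succ_The: "is_succ \<kappa> \<gamma> \<Longrightarrow> (THE \<alpha>. is_succ \<alpha> \<gamma>) = \<kappa>"
  using is_succ_unique by blast

definition filtration :: "('r, 'k) ring_scheme \<Rightarrow> ('r, 'm) module \<Rightarrow> 'o::wellorder \<Rightarrow>
    ('o \<Rightarrow> 'm set) \<Rightarrow> bool"
  where "filtration R M \<mu> F \<longleftrightarrow>
    (\<forall>\<gamma>\<le>\<mu>. submodule (F \<gamma>) R M) \<and>
    (\<forall>\<kappa> \<gamma>. \<kappa> \<le> \<gamma> \<longrightarrow> \<gamma> \<le> \<mu> \<longrightarrow> F \<kappa> \<subseteq> F \<gamma>) \<and>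
    (\<forall>\<gamma>. is_zero \<gamma> \<longrightarrow> F \<gamma> = {\<zero>\<^bsub>M\<^esub>}) \<and>
    F \<mu> = carrier M \<and>
    (\<forall>\<nu>\<le>\<mu>. is_limit \<nu> \<longrightarrow> F \<nu> = (\<Union>\<gamma>\<in>{..<\<nu>}. F \<gamma>))"

definition S_filtration :: "('r, 'k) ring_scheme \<Rightarrow> ('r, 'x) module set \<Rightarrow> ('r, 'm) module \<Rightarrow>
    'o::wellorder \<Rightarrow> ('o \<Rightarrow> 'm set) \<Rightarrow> bool"
  where "S_filtration R \<S> M \<mu> F \<longleftrightarrow> filtration R M \<mu> F \<and>
    (\<forall>\<gamma> \<gamma>'. \<gamma> < \<mu> \<longrightarrow> is_succ \<gamma> \<gamma>' \<longrightarrow>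
      (\<exists>B\<in>\<S>. module_iso R (quot_module (restrict_module M (F \<gamma>')) (F \<gamma>)) B))"

text \<open>
  The modules with an \<open>\<S>\<close>-filtration indexed by ordinals from \<open>'o\<close>.  The class \<open>Filt(\<S>)\<close> is the
  union of these over all well-ordered types \<open>'o\<close>; a theorem about \<open>Filt(\<S>)\<close> leaves \<open>'o\<close> free.
\<close>

definition Filt :: "'o::wellorder itself \<Rightarrow> ('r, 'k) ring_scheme \<Rightarrow> ('r, 'x) module set \<Rightarrow>
    ('r, 'm) module set"
  where "Filt _ R \<S> = {M. left_module R M \<and> (\<exists>(\<mu>::'o) F. S_filtration R \<S> M \<mu> F)}"

text \<open>A sum of submodules is the least submodule containing all of them.\<close>

definition socle :: "('r, 'k) ring_scheme \<Rightarrow> ('r, 'x) module set \<Rightarrow> ('r, 'm) module \<Rightarrow> 'm set"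
  where "socle R \<S> N = \<Inter>{H. submodule H R N \<and> (\<forall>B\<in>\<S>. \<forall>f\<in>Hom R B N. f ` carrier B \<subseteq> H)}"

function socle_filtration :: "('r, 'k) ring_scheme \<Rightarrow> ('r, 'x) module set \<Rightarrow> ('r, 'm) module \<Rightarrow>
    'o::wellorder \<Rightarrow> 'm set"
  where "socle_filtration R \<S> M \<gamma> =
    (if is_zero \<gamma> then {\<zero>\<^bsub>M\<^esub>}
     else if \<exists>\<kappa>. is_succ \<kappa> \<gamma> then
       (let V = socle_filtration R \<S> M (THE \<kappa>. is_succ \<kappa> \<gamma>)
        in {x \<in> carrier M. V +>\<^bsub>M\<^esub> x \<in> socle R \<S> (quot_module M V)})
     else (\<Union>\<kappa>\<in>{..<\<gamma>}. socle_filtration R \<S> M \<kappa>))"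
  by pat_completeness auto
termination
  apply (relation "{((R, \<S>, M, \<kappa>), (R', \<S>', M', \<gamma>)). \<kappa> < \<gamma>}")
  subgoal
    by (rule wf_subset[OF wf_inv_image[OF wf, of "\<lambda>(R, \<S>, M, \<gamma>). \<gamma>"]]) (auto simp: inv_image_def)
  subgoal for R \<S> M \<gamma>
    by (auto simp: is_succ_The) (auto simp: is_succ_def)
  subgoal by simp
  done

declare socle_filtration.simps [simp del]

text \<open>\<open>\<nu>\<close> is the length of the \<open>\<S>\<close>-socle filtration of \<open>M\<close>.\<close>

definition socle_length :: "('r, 'k) ring_scheme \<Rightarrow> ('r, 'x) module set \<Rightarrow> ('r, 'm) module \<Rightarrow>
    'o::wellorder \<Rightarrow> bool"
  where "socle_length R \<S> M \<nu> \<longleftrightarrow> socle_filtration R \<S> M \<nu> = carrier M \<and>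
    (\<forall>\<kappa><\<nu>. socle_filtration R \<S> M \<kappa> \<noteq> carrier M)"


section \<open>Adequacy of \<open>projective\<close>, \<open>proj_dim_le_1\<close> and \<open>Ext1\<close>\<close>

text \<open>The bounds on the types of modules in the first two definitions are harmless, and \<open>Ext1\<close> is
  an abelian group.\<close>

lemma (in left_module) smult_l_null [simp]:
  assumes "x \<in> carrier M" shows "\<zero> \<odot>\<^bsub>M\<^esub> x = \<zero>\<^bsub>M\<^esub>"
proof -
  have "\<zero> \<odot>\<^bsub>M\<^esub> x \<oplus>\<^bsub>M\<^esub> \<zero> \<odot>\<^bsub>M\<^esub> x = \<zero> \<odot>\<^bsub>M\<^esub> x"
    using smult_l_distr[of \<zero> \<zero> x] assms by simp
  then show ?thesis
    using assms by (metis M.add.r_cancel_one' R.zero_closed smult_closed)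
qed

lemma (in left_module) smult_r_null [simp]:
  assumes "a \<in> carrier R" shows "a \<odot>\<^bsub>M\<^esub> \<zero>\<^bsub>M\<^esub> = \<zero>\<^bsub>M\<^esub>"
proof -
  have "a \<odot>\<^bsub>M\<^esub> \<zero>\<^bsub>M\<^esub> \<oplus>\<^bsub>M\<^esub> a \<odot>\<^bsub>M\<^esub> \<zero>\<^bsub>M\<^esub> = a \<odot>\<^bsub>M\<^esub> \<zero>\<^bsub>M\<^esub>"
    using smult_r_distr[of a "\<zero>\<^bsub>M\<^esub>" "\<zero>\<^bsub>M\<^esub>"] assms by simp
  then show ?thesis
    using assms by (metis M.add.r_cancel_one' M.zero_closed smult_closed)
qed

lemma HomD:
  assumes "f \<in> Hom R M N"
  shows "x \<in> carrier M \<Longrightarrow> f x \<in> carrier N"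
    and "x \<in> carrier M \<Longrightarrow> y \<in> carrier M \<Longrightarrow> f (x \<oplus>\<^bsub>M\<^esub> y) = f x \<oplus>\<^bsub>N\<^esub> f y"
    and "a \<in> carrier R \<Longrightarrow> x \<in> carrier M \<Longrightarrow> f (a \<odot>\<^bsub>M\<^esub> x) = a \<odot>\<^bsub>N\<^esub> f x"
    and "f \<in> extensional (carrier M)"
  using assms by (auto simp: Hom_def PiE_iff)

lemma Hom_zero:
  assumes "left_module R M" "left_module R N" "f \<in> Hom R M N"
  shows "f \<zero>\<^bsub>M\<^esub> = \<zero>\<^bsub>N\<^esub>"
proof -
  interpret M: left_module R M by fact
  interpret N: left_module R N by fact
  have "f \<zero>\<^bsub>M\<^esub> = f (\<zero>\<^bsub>R\<^esub> \<odot>\<^bsub>M\<^esub> \<zero>\<^bsub>M\<^esub>)" by simp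
  also have "\<dots> = \<zero>\<^bsub>R\<^esub> \<odot>\<^bsub>N\<^esub> f \<zero>\<^bsub>M\<^esub>" using HomD(3)[OF assms(3)] by blast
  also have "\<dots> = \<zero>\<^bsub>N\<^esub>" using HomD(1)[OF assms(3)] by simp
  finally show ?thesis .
qed

lemma Hom_compose:
  assumes "left_module R M" "f \<in> Hom R M N" "g \<in> Hom R N L"
  shows "compose (carrier M) g f \<in> Hom R M L"
proof -
  interpret M: left_module R M by fact
  show ?thesis
    using HomD[OF assms(2)] HomD[OF assms(3)] by (auto simp: Hom_def compose_def)
qed

lemma Hom_add:
  assumes "left_module R M" "left_module R N" "f \<in> Hom R M N" "g \<in> Hom R M N"
  shows "(\<lambda>x\<in>carrier M. f x \<oplus>\<^bsub>N\<^esub> g x) \<in> Hom R M N"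
proof -
  interpret M: left_module R M by fact
  interpret N: left_module R N by fact
  show ?thesis
    using HomD[OF assms(3)] HomD[OF assms(4)]
    by (auto simp: Hom_def N.smult_r_distr N.M.a_ac)
qed

lemma Hom_minus:
  assumes "left_module R M" "left_module R N" "f \<in> Hom R M N" "x \<in> carrier M"
  shows "f (\<ominus>\<^bsub>M\<^esub> x) = \<ominus>\<^bsub>N\<^esub> f x"
proof -
  interpret M: left_module R M by fact
  interpret N: left_module R N by fact
  have "f (\<ominus>\<^bsub>M\<^esub> x) \<oplus>\<^bsub>N\<^esub> f x = \<zero>\<^bsub>N\<^esub>"
    using HomD(2)[OF assms(3), of "\<ominus>\<^bsub>M\<^esub> x" x] Hom_zero[OF assms(1-3)] assms(4)
    by (simp add: M.M.l_neg)
  then show ?thesis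
    using HomD(1)[OF assms(3)] assms(4)
    by (metis M.M.a_inv_closed N.M.minus_equality)
qed

lemma (in left_module) submodule_left_module:
  assumes "submodule H R M" shows "left_module R (restrict_module M H)"
proof -
  interpret H: submodule H R M by fact
  have inv: "\<ominus>\<^bsub>M\<^esub> x \<in> H" if "x \<in> H" for x
    using H.m_inv_closed[OF that] by (simp add: a_inv_def)
  have sub: "x \<in> carrier M" if "x \<in> H" for x using H.subset that by auto
  have add: "x \<oplus>\<^bsub>M\<^esub> y \<in> H" if "x \<in> H" "y \<in> H" for x y using H.m_closed that by simp
  have zero: "\<zero>\<^bsub>M\<^esub> \<in> H" using H.one_closed by simp
  have "abelian_group (restrict_module M H)"
    by (rule abelian_groupI)
      (use sub add zero inv M.l_neg in \<open>fastforce simp: restrict_module_def M.a_ac\<close>)+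
  then show ?thesis
    by (intro left_module.intro R.ring_axioms left_module_axioms.intro)
      (use sub in \<open>auto simp: restrict_module_def smult_l_distr smult_r_distr smult_assoc1\<close>)
qed

lemma ker_submodule:
  assumes "left_module R M" "left_module R N" "f \<in> Hom R M N"
  shows "submodule (ker M N f) R M"
proof -
  interpret M: left_module R M by fact
  interpret N: left_module R N by fact
  have "subgroup (ker M N f) (add_monoid M)"
    using HomD[OF assms(3)] Hom_zero[OF assms] Hom_minus[OF assms]
    by (intro subgroup.intro) (auto simp: ker_def simp flip: a_inv_def)
  then show ?thesis
    using HomD[OF assms(3)]
    by (intro submodule.intro submodule_axioms.intro) (auto simp: ker_def)
qed

lemma left_module_free_module:
  assumes "ring R" shows "left_module R (free_module R I)"
proof -
  interpret R: ring R by fact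
  have fin: "finite {i \<in> I. (if i \<in> I then x i \<oplus>\<^bsub>R\<^esub> y i else undefined) \<noteq> \<zero>\<^bsub>R\<^esub>}"
    if "finite {i \<in> I. x i \<noteq> \<zero>\<^bsub>R\<^esub>}" "finite {i \<in> I. y i \<noteq> \<zero>\<^bsub>R\<^esub>}" for x y
    by (rule finite_subset[OF _ finite_UnI[OF that]]) auto
  have fin': "finite {i \<in> I. (if i \<in> I then a \<otimes>\<^bsub>R\<^esub> x i else undefined) \<noteq> \<zero>\<^bsub>R\<^esub>}"
    if "finite {i \<in> I. x i \<noteq> \<zero>\<^bsub>R\<^esub>}" "a \<in> carrier R" for x a
    by (rule finite_subset[OF _ that(1)]) (use that in auto)
  have inv: "\<exists>y\<in>carrier (free_module R I). y \<oplus>\<^bsub>free_module R I\<^esub> x = \<zero>\<^bsub>free_module R I\<^esub>"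
    if "x \<in> carrier (free_module R I)" for x
  proof (rule bexI[of _ "\<lambda>i\<in>I. \<ominus>\<^bsub>R\<^esub> x i"])
    have x: "x i \<in> carrier R" if "i \<in> I" for i
      using \<open>x \<in> _\<close> that by (auto simp: free_module_def)
    show "(\<lambda>i\<in>I. \<ominus>\<^bsub>R\<^esub> x i) \<oplus>\<^bsub>free_module R I\<^esub> x = \<zero>\<^bsub>free_module R I\<^esub>"
      using x by (auto simp: free_module_def R.l_neg fun_eq_iff)
    have "finite {i \<in> I. (if i \<in> I then \<ominus>\<^bsub>R\<^esub> x i else undefined) \<noteq> \<zero>\<^bsub>R\<^esub>}"
      using that by (auto simp: free_module_def elim!: rev_finite_subset)
    then show "(\<lambda>i\<in>I. \<ominus>\<^bsub>R\<^esub> x i) \<in> carrier (free_module R I)"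
      using x by (auto simp: free_module_def restrict_def)
  qed
  have "abelian_group (free_module R I)"
  proof (rule abelian_groupI)
    fix x assume "x \<in> carrier (free_module R I)"
    then show "\<exists>y\<in>carrier (free_module R I). y \<oplus>\<^bsub>free_module R I\<^esub> x = \<zero>\<^bsub>free_module R I\<^esub>"
      by (rule inv)
  qed (auto simp: free_module_def restrict_def fin R.a_ac PiE_iff extensional_def fun_eq_iff)
  then show ?thesis
    by (intro left_module.intro assms left_module_axioms.intro)
      (auto simp: free_module_def restrict_def fin' R.l_distr R.r_distr R.m_assoc PiE_iff
        extensional_def fun_eq_iff)
qed

lemma free_lift_eq:
  assumes "left_module R M" "\<phi> \<in> I \<rightarrow> carrier M" "x \<in> carrier (free_module R I)"
    and "finite S" "S \<subseteq> I" "{i \<in> I. x i \<noteq> \<zero>\<^bsub>R\<^esub>} \<subseteq> S"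
  shows "free_lift R I M \<phi> x = (\<Oplus>\<^bsub>M\<^esub>i\<in>S. x i \<odot>\<^bsub>M\<^esub> \<phi> i)"
proof -
  interpret M: left_module R M by fact
  have x: "x i \<in> carrier R" if "i \<in> I" for i using assms(3) that by (auto simp: free_module_def)
  have "(\<Oplus>\<^bsub>M\<^esub>i\<in>{i \<in> I. x i \<noteq> \<zero>\<^bsub>R\<^esub>}. x i \<odot>\<^bsub>M\<^esub> \<phi> i) = (\<Oplus>\<^bsub>M\<^esub>i\<in>S. x i \<odot>\<^bsub>M\<^esub> \<phi> i)"
  proof (rule M.M.add.finprod_mono_neutral_cong_left)
    show "x i \<odot>\<^bsub>M\<^esub> \<phi> i = \<zero>\<^bsub>M\<^esub>" if "i \<in> S - {i \<in> I. x i \<noteq> \<zero>\<^bsub>R\<^esub>}" for i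
    proof -
      have "i \<in> I" "x i = \<zero>\<^bsub>R\<^esub>" using that assms(5) by auto
      then show ?thesis using assms(2) by (simp add: Pi_iff)
    qed
  qed (use assms x in \<open>auto simp: Pi_iff\<close>)
  then show ?thesis using assms(3) by (simp add: free_lift_def)
qed

lemma free_lift_Hom:
  assumes "left_module R M" "\<phi> \<in> I \<rightarrow> carrier M"
  shows "free_lift R I M \<phi> \<in> Hom R (free_module R I) M"
proof -
  interpret M: left_module R M by fact
  let ?F = "free_module R I"
  interpret F: left_module R ?F by (rule left_module_free_module) (rule M.R.ring_axioms)
  let ?supp = "\<lambda>x. {i \<in> I. x i \<noteq> \<zero>\<^bsub>R\<^esub>}"
  have x: "x i \<in> carrier R" if "x \<in> carrier ?F" "i \<in> I" for x i
    using that by (auto simp: free_module_def)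
  have fin: "finite (?supp x)" if "x \<in> carrier ?F" for x
    using that by (auto simp: free_module_def)
  have \<phi>: "\<phi> i \<in> carrier M" if "i \<in> I" for i using assms(2) that by auto
  note eq = free_lift_eq[OF assms]
  show ?thesis unfolding Hom_def
  proof (intro CollectI conjI ballI)
    show "free_lift R I M \<phi> \<in> carrier ?F \<rightarrow>\<^sub>E carrier M"
      using x \<phi> by (auto simp: free_lift_def Pi_iff intro!: M.M.finsum_closed)
  next
    fix u v assume uv: "u \<in> carrier ?F" "v \<in> carrier ?F"
    let ?S = "?supp u \<union> ?supp v"
    have S: "finite ?S" "?S \<subseteq> I" using fin uv by auto
    have add: "(u \<oplus>\<^bsub>?F\<^esub> v) i = u i \<oplus>\<^bsub>R\<^esub> v i" if "i \<in> I" for i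
      using that by (simp add: free_module_def)
    have "?supp (u \<oplus>\<^bsub>?F\<^esub> v) \<subseteq> ?S" by (auto simp: add)
    then have "free_lift R I M \<phi> (u \<oplus>\<^bsub>?F\<^esub> v) = (\<Oplus>\<^bsub>M\<^esub>i\<in>?S. (u \<oplus>\<^bsub>?F\<^esub> v) i \<odot>\<^bsub>M\<^esub> \<phi> i)"
      using uv S by (intro eq) auto
    also have "\<dots> = (\<Oplus>\<^bsub>M\<^esub>i\<in>?S. u i \<odot>\<^bsub>M\<^esub> \<phi> i \<oplus>\<^bsub>M\<^esub> v i \<odot>\<^bsub>M\<^esub> \<phi> i)"
      using S x uv \<phi> by (intro M.M.finsum_cong') (auto simp: add M.smult_l_distr)
    also have "\<dots> = (\<Oplus>\<^bsub>M\<^esub>i\<in>?S. u i \<odot>\<^bsub>M\<^esub> \<phi> i) \<oplus>\<^bsub>M\<^esub> (\<Oplus>\<^bsub>M\<^esub>i\<in>?S. v i \<odot>\<^bsub>M\<^esub> \<phi> i)"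
      using x uv \<phi> by (intro M.M.finsum_addf) auto
    also have "\<dots> = free_lift R I M \<phi> u \<oplus>\<^bsub>M\<^esub> free_lift R I M \<phi> v"
      using uv S eq[of u ?S] eq[of v ?S] by auto
    finally show "free_lift R I M \<phi> (u \<oplus>\<^bsub>?F\<^esub> v) = free_lift R I M \<phi> u \<oplus>\<^bsub>M\<^esub> free_lift R I M \<phi> v" .
  next
    fix a u assume au: "a \<in> carrier R" "u \<in> carrier ?F"
    have smult: "(a \<odot>\<^bsub>?F\<^esub> u) i = a \<otimes>\<^bsub>R\<^esub> u i" if "i \<in> I" for i
      using that by (simp add: free_module_def)
    have sum: "(\<Oplus>\<^bsub>M\<^esub>i\<in>S. (a \<otimes>\<^bsub>R\<^esub> u i) \<odot>\<^bsub>M\<^esub> \<phi> i) = a \<odot>\<^bsub>M\<^esub> (\<Oplus>\<^bsub>M\<^esub>i\<in>S. u i \<odot>\<^bsub>M\<^esub> \<phi> i)"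
      if "finite S" "S \<subseteq> I" for S
      using that
    proof (induction S)
      case empty
      then show ?case using au by simp
    next
      case (insert j S)
      then have "u j \<in> carrier R" "\<phi> j \<in> carrier M" "(\<lambda>i. u i \<odot>\<^bsub>M\<^esub> \<phi> i) \<in> S \<rightarrow> carrier M"
        "(\<lambda>i. (a \<otimes>\<^bsub>R\<^esub> u i) \<odot>\<^bsub>M\<^esub> \<phi> i) \<in> S \<rightarrow> carrier M"
        using x au \<phi> by auto
      with insert show ?case
        using au by (simp add: M.M.finsum_closed M.smult_r_distr M.smult_assoc1)
    qed
    have S: "finite (?supp u)" using fin au by auto
    have "?supp (a \<odot>\<^bsub>?F\<^esub> u) \<subseteq> ?supp u" using au by (auto simp: smult)
    then have "free_lift R I M \<phi> (a \<odot>\<^bsub>?F\<^esub> u) = (\<Oplus>\<^bsub>M\<^esub>i\<in>?supp u. (a \<odot>\<^bsub>?F\<^esub> u) i \<odot>\<^bsub>M\<^esub> \<phi> i)"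
      using au S by (intro eq) auto
    also have "\<dots> = (\<Oplus>\<^bsub>M\<^esub>i\<in>?supp u. (a \<otimes>\<^bsub>R\<^esub> u i) \<odot>\<^bsub>M\<^esub> \<phi> i)"
      using x au \<phi> by (intro M.M.finsum_cong') (auto simp: smult)
    also have "\<dots> = a \<odot>\<^bsub>M\<^esub> free_lift R I M \<phi> u"
      using sum[OF S] eq[OF au(2) S] by auto
    finally show "free_lift R I M \<phi> (a \<odot>\<^bsub>?F\<^esub> u) = a \<odot>\<^bsub>M\<^esub> free_lift R I M \<phi> u" .
  qed
qed

definition unit_vec :: "('r, 'k) ring_scheme \<Rightarrow> 'i set \<Rightarrow> 'i \<Rightarrow> 'i \<Rightarrow> 'r"
  where "unit_vec R I j = (\<lambda>i\<in>I. if i = j then \<one>\<^bsub>R\<^esub> else \<zero>\<^bsub>R\<^esub>)"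

lemma unit_vec_closed:
  assumes "ring R" shows "unit_vec R I j \<in> carrier (free_module R I)"
proof -
  interpret R: ring R by fact
  have "{i \<in> I. unit_vec R I j i \<noteq> \<zero>\<^bsub>R\<^esub>} \<subseteq> {j}" by (auto simp: unit_vec_def)
  then have "finite {i \<in> I. unit_vec R I j i \<noteq> \<zero>\<^bsub>R\<^esub>}" by (rule finite_subset) simp
  then show ?thesis by (simp add: free_module_def) (auto simp: unit_vec_def)
qed

lemma free_lift_unit_vec:
  assumes "left_module R M" "\<phi> \<in> I \<rightarrow> carrier M" "j \<in> I"
  shows "free_lift R I M \<phi> (unit_vec R I j) = \<phi> j"
proof -
  interpret M: left_module R M by fact
  have "free_lift R I M \<phi> (unit_vec R I j) = (\<Oplus>\<^bsub>M\<^esub>i\<in>{j}. unit_vec R I j i \<odot>\<^bsub>M\<^esub> \<phi> i)"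
    using assms by (intro free_lift_eq unit_vec_closed) (auto simp: unit_vec_def M.R.ring_axioms)
  also have "\<dots> = \<phi> j" using assms by (simp add: unit_vec_def Pi_iff)
  finally show ?thesis .
qed

lemma free_module_Hom_eqI:
  assumes "left_module R M" and f: "f \<in> Hom R (free_module R I) M"
    and g: "g \<in> Hom R (free_module R I) M"
    and eq: "\<And>i. i \<in> I \<Longrightarrow> f (unit_vec R I i) = g (unit_vec R I i)"
  shows "f = g"
proof -
  interpret M: left_module R M by fact
  let ?F = "free_module R I"
  interpret F: left_module R ?F by (rule left_module_free_module) (rule M.R.ring_axioms)
  note unit = unit_vec_closed[OF M.R.ring_axioms, of I]
  have "f x = g x" if "finite S" "x \<in> carrier ?F" "{i \<in> I. x i \<noteq> \<zero>\<^bsub>R\<^esub>} \<subseteq> S" "S \<subseteq> I" for S x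
    using that
  proof (induction S arbitrary: x)
    case empty
    then have "x = \<zero>\<^bsub>?F\<^esub>" by (auto simp: free_module_def fun_eq_iff PiE_iff extensional_def)
    then show ?case
      using Hom_zero[OF F.left_module_axioms assms(1)] f g by metis
  next
    case (insert j S)
    let ?y = "\<lambda>i\<in>I. if i = j then \<zero>\<^bsub>R\<^esub> else x i"
    have xi: "x i \<in> carrier R" if "i \<in> I" for i using insert.prems(1) that by (auto simp: free_module_def)
    have supp: "{i \<in> I. ?y i \<noteq> \<zero>\<^bsub>R\<^esub>} \<subseteq> S" using insert.prems(2) by auto
    have y: "?y \<in> carrier ?F"
      using xi finite_subset[OF supp insert.hyps(1)] by (simp add: free_module_def)
    have x: "x = ?y \<oplus>\<^bsub>?F\<^esub> x j \<odot>\<^bsub>?F\<^esub> unit_vec R I j"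
      using insert.prems xi
      by (auto simp: free_module_def unit_vec_def fun_eq_iff PiE_iff extensional_def)
    have j: "j \<in> I" using insert.prems by auto
    have h: "h x = h ?y \<oplus>\<^bsub>M\<^esub> x j \<odot>\<^bsub>M\<^esub> h (unit_vec R I j)" if "h \<in> Hom R ?F M" for h
      by (subst x)
        (simp only: HomD(2,3)[OF that] xi[OF j] y unit F.smult_closed)
    show ?case
      unfolding h[OF f] h[OF g] eq[OF j] using insert.IH[OF y supp] insert.prems(3) by (simp only: insert_subset)
  qed
  then have "f x = g x" if "x \<in> carrier ?F" for x
    using that by (auto simp: free_module_def)
  then show ?thesis using HomD(4)[OF f] HomD(4)[OF g] by (rule extensionalityI[rotated 2])
qed

lemma free_module_lift:
  assumes "left_module R A" "left_module R B" "g \<in> Hom R A B" "g ` carrier A = carrier B"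
    and f: "f \<in> Hom R (free_module R I) B"
  shows "\<exists>h\<in>Hom R (free_module R I) A. compose (carrier (free_module R I)) g h = f"
proof -
  interpret A: left_module R A by fact
  interpret B: left_module R B by fact
  let ?F = "free_module R I"
  interpret F: left_module R ?F by (rule left_module_free_module) (rule A.R.ring_axioms)
  note unit = unit_vec_closed[OF A.R.ring_axioms, of I]
  have "\<forall>i. \<exists>a\<in>carrier A. g a = f (unit_vec R I i)"
    using HomD(1)[OF f unit] assms(4) by (metis imageE)
  then obtain \<phi> where \<phi>: "\<And>i. \<phi> i \<in> carrier A" "\<And>i. g (\<phi> i) = f (unit_vec R I i)"
    by metis
  let ?h = "free_lift R I A \<phi>"
  have h: "?h \<in> Hom R ?F A" using \<phi> by (intro free_lift_Hom assms) auto
  have "compose (carrier ?F) g ?h = f"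
  proof (rule free_module_Hom_eqI[OF assms(2) Hom_compose[OF F.left_module_axioms h assms(3)] f])
    fix i assume "i \<in> I"
    then have "?h (unit_vec R I i) = \<phi> i" using \<phi> by (intro free_lift_unit_vec assms) auto
    then show "compose (carrier ?F) g ?h (unit_vec R I i) = f (unit_vec R I i)"
      using unit \<phi> by (simp add: compose_def)
  qed
  with h show ?thesis by blast
qed

lemma cover_Hom: "left_module R M \<Longrightarrow> cover R M \<in> Hom R (free_module R (carrier M)) M"
  unfolding cover_def by (rule free_lift_Hom) auto

lemma cover_surj:
  assumes "left_module R M" shows "cover R M ` carrier (free_module R (carrier M)) = carrier M"
proof -
  interpret M: left_module R M by fact
  have "x \<in> cover R M ` carrier (free_module R (carrier M))" if "x \<in> carrier M" for x
    using free_lift_unit_vec[OF assms, of "\<lambda>x. x" "carrier M" x] that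
      unit_vec_closed[OF M.R.ring_axioms, of "carrier M" x]
    by (metis Pi_I cover_def rev_image_eqI)
  then show ?thesis using HomD(1)[OF cover_Hom[OF assms]] by auto
qed

lemma left_module_syzygy:
  assumes "left_module R M" shows "left_module R (syzygy R M)"
proof -
  interpret M: left_module R M by fact
  have F: "left_module R (free_module R (carrier M))"
    by (rule left_module_free_module) (rule M.R.ring_axioms)
  show ?thesis unfolding syzygy_def
    by (intro left_module.submodule_left_module F ker_submodule assms cover_Hom)
qed

theorem projective_lift:
  fixes P :: "('r, 'p) module" and A :: "('r, 'a) module" and B :: "('r, 'b) module"
  assumes "projective R P" and A: "left_module R A" and B: "left_module R B"
    and g: "g \<in> Hom R A B" "g ` carrier A = carrier B" and f: "f \<in> Hom R P B"
  shows "\<exists>h\<in>Hom R P A. compose (carrier P) g h = f"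
proof -
  have P: "left_module R P" using assms(1) by (simp add: projective_def)
  interpret P: left_module R P by fact
  let ?F = "free_module R (carrier P)"
  have F: "left_module R ?F" by (rule left_module_free_module) (rule P.R.ring_axioms)
  have "(\<lambda>x\<in>carrier P. x) \<in> Hom R P P" by (auto simp: Hom_def)
  then obtain s where s: "s \<in> Hom R P ?F" "compose (carrier P) (cover R P) s = (\<lambda>x\<in>carrier P. x)"
    using assms(1) F cover_Hom[OF P] cover_surj[OF P] P unfolding projective_def by blast
  obtain k where k: "k \<in> Hom R ?F A"
    "compose (carrier ?F) g k = compose (carrier ?F) f (cover R P)"
    using free_module_lift[OF A B g Hom_compose[OF F cover_Hom[OF P] f]] by blast
  have "compose (carrier P) g (compose (carrier P) k s) = f"
  proof (rule extensionalityI)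
    fix x assume x: "x \<in> carrier P"
    have "g (k (s x)) = f (cover R P (s x))"
      using fun_cong[OF k(2), of "s x"] HomD(1)[OF s(1) x] by (simp add: compose_def)
    also have "cover R P (s x) = x" using fun_cong[OF s(2), of x] x by (simp add: compose_def)
    finally show "compose (carrier P) g (compose (carrier P) k s) x = f x"
      using x by (simp add: compose_def)
  qed (use HomD(4)[OF f] in auto)
  then show ?thesis using Hom_compose[OF P s(1) k(1)] by blast
qed

lemma projective_free_module:
  assumes "ring R" shows "projective R (free_module R I)"
  unfolding projective_def
  by (intro conjI allI ballI impI left_module_free_module[OF assms] free_module_lift)

theorem proj_dim_le_1I:
  fixes M :: "('r, 'm) module" and P\<^sub>0 :: "('r, 'p) module" and P\<^sub>1 :: "('r, 'q) module"
  assumes M: "left_module R M" and proj: "projective R P\<^sub>0" "projective R P\<^sub>1"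
    and d: "d \<in> Hom R P\<^sub>1 P\<^sub>0" "inj_on d (carrier P\<^sub>1)" "d ` carrier P\<^sub>1 = ker P\<^sub>0 M p"
    and p: "p \<in> Hom R P\<^sub>0 M" "p ` carrier P\<^sub>0 = carrier M"
  shows "proj_dim_le_1 R M"
proof -
  interpret M: left_module R M by fact
  have P0: "left_module R P\<^sub>0" and P1: "left_module R P\<^sub>1"
    using proj by (auto simp: projective_def)
  interpret P0: left_module R P\<^sub>0 by fact
  interpret P1: left_module R P\<^sub>1 by fact
  let ?F = "free_module R (carrier M)" and ?c = "cover R M" and ?K = "syzygy R M"
  have F: "left_module R ?F" by (rule left_module_free_module) (rule M.R.ring_axioms)
  interpret F: left_module R ?F by fact
  have K: "left_module R ?K" by (rule left_module_syzygy[OF M])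
  interpret K: left_module R ?K by fact
  have c: "?c \<in> Hom R ?F M" by (rule cover_Hom[OF M])
  have Kc: "carrier ?K = ker ?F M ?c" and Kops: "x \<oplus>\<^bsub>?K\<^esub> y = x \<oplus>\<^bsub>?F\<^esub> y" "a \<odot>\<^bsub>?K\<^esub> x = a \<odot>\<^bsub>?F\<^esub> x" for x y a
    by (simp_all add: syzygy_def restrict_module_def)
  have KF: "x \<in> carrier ?F" "?c x = \<zero>\<^bsub>M\<^esub>" if "x \<in> carrier ?K" for x
    using that by (auto simp: Kc ker_def)
  \<comment> \<open>comparison maps between the two resolutions\<close>
  obtain \<alpha> where \<alpha>: "\<alpha> \<in> Hom R ?F P\<^sub>0" "compose (carrier ?F) p \<alpha> = ?c"
    using free_module_lift[OF P0 M p c] by blast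
  obtain \<beta> where \<beta>: "\<beta> \<in> Hom R P\<^sub>0 ?F" "compose (carrier P\<^sub>0) ?c \<beta> = p"
    using projective_lift[OF proj(1) F M c cover_surj[OF M] p(1)] by blast
  have p\<alpha>: "p (\<alpha> x) = ?c x" if "x \<in> carrier ?F" for x
    using fun_cong[OF \<alpha>(2), of x] that by (simp add: compose_def)
  have c\<beta>: "?c (\<beta> x) = p x" if "x \<in> carrier P\<^sub>0" for x
    using fun_cong[OF \<beta>(2), of x] that by (simp add: compose_def)
  have dP0: "d y \<in> carrier P\<^sub>0" "p (d y) = \<zero>\<^bsub>M\<^esub>" if "y \<in> carrier P\<^sub>1" for y
    using that d(3) by (auto simp: ker_def)
  define \<gamma> where "\<gamma> = (\<lambda>x\<in>carrier ?K. the_inv_into (carrier P\<^sub>1) d (\<alpha> x))"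
  have \<alpha>K: "\<alpha> x \<in> d ` carrier P\<^sub>1" if "x \<in> carrier ?K" for x
    using KF[OF that] p\<alpha> HomD(1)[OF \<alpha>(1)] by (auto simp: d(3) ker_def)
  have d\<gamma>: "d (\<gamma> x) = \<alpha> x" and \<gamma>c: "\<gamma> x \<in> carrier P\<^sub>1" if "x \<in> carrier ?K" for x
    using that \<alpha>K[OF that] d(2) the_inv_into_into[OF d(2), of "\<alpha> x" "carrier P\<^sub>1"]
    by (auto simp: \<gamma>_def f_the_inv_into_f)
  have inj: "y = z" if "d y = d z" "y \<in> carrier P\<^sub>1" "z \<in> carrier P\<^sub>1" for y z
    using inj_onD[OF d(2) that] .
  have \<gamma>: "\<gamma> \<in> Hom R ?K P\<^sub>1"
    unfolding Hom_def
  proof (intro CollectI conjI ballI)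
    show "\<gamma> \<in> carrier ?K \<rightarrow>\<^sub>E carrier P\<^sub>1" using \<gamma>c by (auto simp: \<gamma>_def)
  next
    fix x y assume xy: "x \<in> carrier ?K" "y \<in> carrier ?K"
    then have "x \<oplus>\<^bsub>?K\<^esub> y \<in> carrier ?K" by simp
    with xy show "\<gamma> (x \<oplus>\<^bsub>?K\<^esub> y) = \<gamma> x \<oplus>\<^bsub>P\<^sub>1\<^esub> \<gamma> y"
      by (intro inj) (auto simp: d\<gamma> \<gamma>c HomD(2)[OF d(1)] HomD(2)[OF \<alpha>(1)] Kops KF)
  next
    fix a x assume ax: "a \<in> carrier R" "x \<in> carrier ?K"
    then have "a \<odot>\<^bsub>?K\<^esub> x \<in> carrier ?K" by simp
    with ax show "\<gamma> (a \<odot>\<^bsub>?K\<^esub> x) = a \<odot>\<^bsub>P\<^sub>1\<^esub> \<gamma> x"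
      by (intro inj) (auto simp: d\<gamma> \<gamma>c HomD(3)[OF d(1)] HomD(3)[OF \<alpha>(1)] Kops KF)
  qed
  \<comment> \<open>the syzygy is a retract of the direct sum of \<open>P\<^sub>1\<close> and the free module\<close>
  have \<beta>d: "\<beta> (d y) \<in> carrier ?K" if "y \<in> carrier P\<^sub>1" for y
    using dP0[OF that] HomD(1)[OF \<beta>(1)] c\<beta> by (auto simp: Kc ker_def)
  define r\<^sub>1 where "r\<^sub>1 = (\<lambda>y\<in>carrier P\<^sub>1. \<beta> (d y))"
  have r1: "r\<^sub>1 \<in> Hom R P\<^sub>1 ?K"
    unfolding Hom_def
    by (auto simp: r\<^sub>1_def \<beta>d Kops HomD(2,3)[OF d(1)] HomD(2,3)[OF \<beta>(1)] dP0)
  have \<beta>\<alpha>: "\<beta> (\<alpha> x) \<in> carrier ?F" "?c (\<beta> (\<alpha> x)) = ?c x" if "x \<in> carrier ?F" for x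
    using that HomD(1)[OF \<alpha>(1)] HomD(1)[OF \<beta>(1)] c\<beta> p\<alpha> by auto
  define r\<^sub>2 where "r\<^sub>2 = (\<lambda>x\<in>carrier ?F. x \<ominus>\<^bsub>?F\<^esub> \<beta> (\<alpha> x))"
  have r2K: "x \<ominus>\<^bsub>?F\<^esub> \<beta> (\<alpha> x) \<in> carrier ?K" if "x \<in> carrier ?F" for x
    using that \<beta>\<alpha>[OF that] HomD(1)[OF c that]
    by (auto simp: Kc ker_def a_minus_def HomD(2)[OF c] Hom_minus[OF F M c] M.M.r_neg)
  have r2: "r\<^sub>2 \<in> Hom R ?F ?K"
    unfolding Hom_def
  proof (intro CollectI conjI ballI)
    show "r\<^sub>2 \<in> carrier ?F \<rightarrow>\<^sub>E carrier ?K" using r2K by (auto simp: r\<^sub>2_def)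
  next
    fix x y assume xy: "x \<in> carrier ?F" "y \<in> carrier ?F"
    then show "r\<^sub>2 (x \<oplus>\<^bsub>?F\<^esub> y) = r\<^sub>2 x \<oplus>\<^bsub>?K\<^esub> r\<^sub>2 y"
      using \<beta>\<alpha>(1)[OF xy(1)] \<beta>\<alpha>(1)[OF xy(2)]
      by (simp add: r\<^sub>2_def Kops HomD(1,2)[OF \<alpha>(1)] HomD(1,2)[OF \<beta>(1)] a_minus_def
          F.M.minus_add F.M.a_ac)
  next
    fix a x assume ax: "a \<in> carrier R" "x \<in> carrier ?F"
    have "\<ominus>\<^bsub>?F\<^esub> (a \<odot>\<^bsub>?F\<^esub> z) = a \<odot>\<^bsub>?F\<^esub> (\<ominus>\<^bsub>?F\<^esub> z)" if "z \<in> carrier ?F" for z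
      using F.smult_r_distr[of a z "\<ominus>\<^bsub>?F\<^esub> z"] that ax F.M.r_neg
      by (metis F.M.a_inv_closed F.M.add.inv_equality F.M.add.m_comm F.smult_closed F.smult_r_null)
    with ax show "r\<^sub>2 (a \<odot>\<^bsub>?F\<^esub> x) = a \<odot>\<^bsub>?K\<^esub> r\<^sub>2 x"
      using \<beta>\<alpha>(1)[OF ax(2)]
      by (simp add: r\<^sub>2_def Kops HomD(1,3)[OF \<alpha>(1)] HomD(1,3)[OF \<beta>(1)] a_minus_def
          F.smult_r_distr)
  qed
  have retract: "r\<^sub>1 (\<gamma> x) \<oplus>\<^bsub>?K\<^esub> r\<^sub>2 x = x" if "x \<in> carrier ?K" for x
    using that KF[OF that] \<beta>\<alpha>[of x]
    by (simp add: r\<^sub>1_def r\<^sub>2_def \<gamma>c d\<gamma> Kops a_minus_def F.M.a_ac F.M.r_neg F.M.r_neg2 F.M.r_neg1)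
  have \<iota>: "(\<lambda>x\<in>carrier ?K. x) \<in> Hom R ?K ?F"
    by (auto simp: Hom_def KF) (auto simp: Kops dest: K.M.a_closed K.smult_closed)
  have "projective R ?K"
    unfolding projective_def
  proof (intro conjI K allI ballI impI)
    fix A :: "('r, ('m \<Rightarrow> 'r) \<Rightarrow> 'r) module" and B :: "('r, 'm \<Rightarrow> 'r) module" and g f
    assume g: "g \<in> Hom R A B" and f: "f \<in> Hom R ?K B" and A: "left_module R A"
      and B: "left_module R B" and surj: "g ` carrier A = carrier B"
    interpret A: left_module R A by fact
    obtain h\<^sub>1 where h1: "h\<^sub>1 \<in> Hom R P\<^sub>1 A" "compose (carrier P\<^sub>1) g h\<^sub>1 = compose (carrier P\<^sub>1) f r\<^sub>1"
      using projective_lift[OF proj(2) A B g surj Hom_compose[OF P1 r1 f]] by blast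
    obtain h\<^sub>2 where h2: "h\<^sub>2 \<in> Hom R ?F A" "compose (carrier ?F) g h\<^sub>2 = compose (carrier ?F) f r\<^sub>2"
      using free_module_lift[OF A B g surj Hom_compose[OF F r2 f]] by blast
    have gh1: "g (h\<^sub>1 y) = f (r\<^sub>1 y)" if "y \<in> carrier P\<^sub>1" for y
      using fun_cong[OF h1(2), of y] that by (simp add: compose_def)
    have gh2: "g (h\<^sub>2 y) = f (r\<^sub>2 y)" if "y \<in> carrier ?F" for y
      using fun_cong[OF h2(2), of y] that by (simp add: compose_def)
    let ?h = "\<lambda>x\<in>carrier ?K. compose (carrier ?K) h\<^sub>1 \<gamma> x \<oplus>\<^bsub>A\<^esub>
      compose (carrier ?K) h\<^sub>2 (\<lambda>x\<in>carrier ?K. x) x"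
    have h: "?h \<in> Hom R ?K A"
      by (rule Hom_add[OF K A Hom_compose[OF K \<gamma> h1(1)] Hom_compose[OF K \<iota> h2(1)]])
    have "compose (carrier ?K) g ?h = f"
    proof (rule extensionalityI)
      fix x assume x: "x \<in> carrier ?K"
      have "g (h\<^sub>1 (\<gamma> x) \<oplus>\<^bsub>A\<^esub> h\<^sub>2 x) = f (r\<^sub>1 (\<gamma> x)) \<oplus>\<^bsub>B\<^esub> f (r\<^sub>2 x)"
        using x KF[OF x] \<gamma>c[OF x] HomD(1)[OF h1(1)] HomD(1)[OF h2(1)]
        by (simp add: HomD(2)[OF g] gh1 gh2)
      also have "\<dots> = f x"
        using retract[OF x] HomD(2)[OF f] HomD(1)[OF r1] HomD(1)[OF r2] \<gamma>c[OF x] KF[OF x] by metis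
      finally show "compose (carrier ?K) g ?h x = f x" using x by (simp add: compose_def)
    qed (use HomD(4)[OF f] in auto)
    then show "\<exists>h\<in>Hom R ?K A. compose (carrier ?K) g h = f" using h by blast
  qed
  moreover have "projective R ?F" by (rule projective_free_module) (rule M.R.ring_axioms)
  moreover have "inj_on (\<lambda>x\<in>carrier ?K. x) (carrier ?K)"
    "(\<lambda>x\<in>carrier ?K. x) ` carrier ?K = ker ?F M ?c"
    by (auto simp: inj_on_def Kc)
  ultimately show ?thesis
    unfolding proj_dim_le_1_def using \<iota> c cover_surj[OF M] by blast
qed

lemma comm_group_Hom_group:
  assumes M: "left_module R M" and N: "left_module R N"
  shows "comm_group (Hom_group R M N)"
proof -
  interpret M: left_module R M by fact
  interpret N: left_module R N by fact
  have neg: "(\<lambda>x\<in>carrier M. \<ominus>\<^bsub>N\<^esub> f x) \<in> Hom R M N" if f: "f \<in> Hom R M N" for f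
  proof -
    have "\<ominus>\<^bsub>N\<^esub> (a \<odot>\<^bsub>N\<^esub> z) = a \<odot>\<^bsub>N\<^esub> (\<ominus>\<^bsub>N\<^esub> z)" if "z \<in> carrier N" "a \<in> carrier R" for a z
      using N.smult_r_distr[of a z "\<ominus>\<^bsub>N\<^esub> z"] that N.M.r_neg
      by (metis N.M.a_inv_closed N.M.add.inv_equality N.M.add.m_comm N.smult_closed N.smult_r_null)
    then show ?thesis
      using HomD(1-3)[OF f] by (auto simp: Hom_def N.M.minus_add)
  qed
  show ?thesis
  proof (rule comm_groupI)
    fix f assume "f \<in> carrier (Hom_group R M N)"
    then have f: "f \<in> Hom R M N" by (simp add: Hom_group_def)
    show "\<exists>g\<in>carrier (Hom_group R M N). g \<otimes>\<^bsub>Hom_group R M N\<^esub> f = \<one>\<^bsub>Hom_group R M N\<^esub>"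
      using neg[OF f] HomD(1)[OF f]
      by (intro bexI[of _ "\<lambda>x\<in>carrier M. \<ominus>\<^bsub>N\<^esub> f x"])
        (auto simp: Hom_group_def zero_map_def N.M.l_neg fun_eq_iff)
    show "\<one>\<^bsub>Hom_group R M N\<^esub> \<otimes>\<^bsub>Hom_group R M N\<^esub> f = f"
      using HomD(1,4)[OF f] by (auto simp: Hom_group_def zero_map_def fun_eq_iff extensional_def)
  next
    show "\<one>\<^bsub>Hom_group R M N\<^esub> \<in> carrier (Hom_group R M N)"
      by (auto simp: Hom_group_def zero_map_def Hom_def)
  next
    fix f g h assume "f \<in> carrier (Hom_group R M N)" "g \<in> carrier (Hom_group R M N)"
      "h \<in> carrier (Hom_group R M N)"
    then have fgh: "f \<in> Hom R M N" "g \<in> Hom R M N" "h \<in> Hom R M N" by (auto simp: Hom_group_def)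
    show "f \<otimes>\<^bsub>Hom_group R M N\<^esub> g \<otimes>\<^bsub>Hom_group R M N\<^esub> h
        = f \<otimes>\<^bsub>Hom_group R M N\<^esub> (g \<otimes>\<^bsub>Hom_group R M N\<^esub> h)"
      using HomD(1)[OF fgh(1)] HomD(1)[OF fgh(2)] HomD(1)[OF fgh(3)]
      by (auto simp: Hom_group_def N.M.a_assoc fun_eq_iff)
  next
    fix f g assume "f \<in> carrier (Hom_group R M N)" "g \<in> carrier (Hom_group R M N)"
    then have fg: "f \<in> Hom R M N" "g \<in> Hom R M N" by (auto simp: Hom_group_def)
    show "f \<otimes>\<^bsub>Hom_group R M N\<^esub> g \<in> carrier (Hom_group R M N)"
      using Hom_add[OF M N fg] by (simp add: Hom_group_def)
    show "f \<otimes>\<^bsub>Hom_group R M N\<^esub> g = g \<otimes>\<^bsub>Hom_group R M N\<^esub> f"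
      using HomD(1)[OF fg(1)] HomD(1)[OF fg(2)]
      by (auto simp: Hom_group_def N.M.a_comm fun_eq_iff)
  qed
qed

lemma Hom_group_precompose:
  assumes L: "left_module R L" and M: "left_module R M" and N: "left_module R N"
    and d: "d \<in> Hom R L M"
  shows "(\<lambda>f. compose (carrier L) f d) \<in> hom (Hom_group R M N) (Hom_group R L N)"
  using Hom_compose[OF L d] HomD(1)[OF d]
  by (auto simp: hom_def Hom_group_def compose_def fun_eq_iff)

theorem comm_group_Ext1:
  assumes M: "left_module R M" and N: "left_module R N"
  shows "comm_group (Ext1 R M N)"
proof -
  interpret M: left_module R M by fact
  interpret N: left_module R N by fact
  let ?P0 = "free_module R (carrier M)"
  let ?P1 = "free_module R (carrier (syzygy R M))"
  let ?P2 = "free_module R (carrier (syzygy R (syzygy R M)))"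
  let ?d1 = "cover R (syzygy R M)"
  let ?d2 = "cover R (syzygy R (syzygy R M))"
  let ?Z = "{f \<in> Hom R ?P1 N. compose (carrier ?P2) f ?d2 = zero_map ?P2 N}"
  let ?B = "{compose (carrier ?P1) g ?d1 | g. g \<in> Hom R ?P0 N}"
  have K: "left_module R (syzygy R M)" "left_module R (syzygy R (syzygy R M))"
    by (intro left_module_syzygy M)+
  have P: "left_module R ?P0" "left_module R ?P1" "left_module R ?P2"
    by (rule left_module_free_module, rule M.R.ring_axioms)+
  have incl: "f \<in> Hom R L (free_module R (carrier X))" if "f \<in> Hom R L (syzygy R X)"
    for f L and X :: "('a, 'x) module"
    using that by (auto simp: Hom_def syzygy_def restrict_module_def ker_def PiE_iff)
  have d: "?d1 \<in> Hom R ?P1 ?P0" "?d2 \<in> Hom R ?P2 ?P1"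
    by (intro incl cover_Hom K)+
  have dd: "?d1 (?d2 x) = \<zero>\<^bsub>?P0\<^esub>" if "x \<in> carrier ?P2" for x
    using HomD(1)[OF cover_Hom[OF K(2)] that]
    by (auto simp: syzygy_def[of R "syzygy R M"] restrict_module_def ker_def)
      (simp add: syzygy_def restrict_module_def)
  interpret H: comm_group "Hom_group R ?P1 N" by (rule comm_group_Hom_group[OF P(2) N])
  interpret H2: comm_group "Hom_group R ?P2 N" by (rule comm_group_Hom_group[OF P(3) N])
  interpret H0: comm_group "Hom_group R ?P0 N" by (rule comm_group_Hom_group[OF P(1) N])
  interpret d2: group_hom "Hom_group R ?P1 N" "Hom_group R ?P2 N" "\<lambda>f. compose (carrier ?P2) f ?d2"
    by unfold_locales (rule Hom_group_precompose[OF P(3,2) N d(2)])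
  interpret d1: group_hom "Hom_group R ?P0 N" "Hom_group R ?P1 N" "\<lambda>f. compose (carrier ?P1) f ?d1"
    by unfold_locales (rule Hom_group_precompose[OF P(2,1) N d(1)])
  have Z: "subgroup ?Z (Hom_group R ?P1 N)"
    using d2.subgroup_kernel by (simp add: kernel_def Hom_group_def)
  have "subgroup ?B (Hom_group R ?P1 N)"
    using d1.img_is_subgroup by (simp add: Hom_group_def image_def Setcompr_eq_image Bex_def conj_commute)
  moreover have "?B \<subseteq> ?Z"
  proof (clarify, intro conjI)
    fix g assume g: "g \<in> Hom R ?P0 N"
    show "compose (carrier ?P1) g ?d1 \<in> Hom R ?P1 N" by (rule Hom_compose[OF P(2) d(1) g])
    show "compose (carrier ?P2) (compose (carrier ?P1) g ?d1) ?d2 = zero_map ?P2 N"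
      using HomD(1)[OF d(2)] dd Hom_zero[OF P(1) N g] by (auto simp: compose_def zero_map_def)
  qed
  ultimately have B: "subgroup ?B ((Hom_group R ?P1 N)\<lparr>carrier := ?Z\<rparr>)"
    using H.subgroup_incl[OF _ Z] by blast
  have "comm_group ((Hom_group R ?P1 N)\<lparr>carrier := ?Z\<rparr>)"
    by (rule group.group_comm_groupI[OF H.subgroup_imp_group[OF Z]])
      (use H.m_comm subgroup.subset[OF Z] in \<open>auto simp: subset_iff\<close>)
  then show ?thesis
    unfolding Ext1_def Let_def using comm_group.abelian_FactGroup B by blast
qed

end

theory Submission
  imports Defs
begin

text \<open>
  Let \<open>(F\<^sub>\<gamma>)\<close> be an \<open>\<S>\<close>-filtration and
  \<open>(V\<^sub>\<gamma>)\<close> the \<open>\<S>\<close>-socle filtration of \<open>M\<close>, and suppose that \<open>F\<^sub>\<gamma>\<close> lies in the union of the \<open>V\<^sub>k\<close> with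
  \<open>k\<close> finite.  Write \<open>F\<^sub>\<gamma>\<^sub>+\<^sub>1/F\<^sub>\<gamma> \<cong> R\<^sup>n/K\<close> with \<open>K\<close> finitely generated and lift \<open>R\<^sup>n \<rightarrow> F\<^sub>\<gamma>\<^sub>+\<^sub>1/F\<^sub>\<gamma>\<close> to
  \<open>h : R\<^sup>n \<rightarrow> F\<^sub>\<gamma>\<^sub>+\<^sub>1\<close>.  Then \<open>h(K) \<subseteq> F\<^sub>\<gamma>\<close> is finitely generated, so it lies in a single \<open>V\<^sub>k\<close>, and \<open>h\<close>
  induces a homomorphism \<open>R\<^sup>n/K \<rightarrow> M/V\<^sub>k\<close>, whose image is in the socle.  Hence \<open>h(R\<^sup>n) \<subseteq> V\<^sub>k\<^sub>+\<^sub>1\<close> and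
  \<open>F\<^sub>\<gamma>\<^sub>+\<^sub>1 = F\<^sub>\<gamma> + h(R\<^sup>n)\<close> lies in the same union.  So the length is at most \<open>\<omega>\<close>.
\<close>

section \<open>Quotient modules\<close>

lemma submodule_mem:
  assumes "submodule H R M" and "x \<in> H" shows "x \<in> carrier M"
  using assms subgroup.subset[of H "add_monoid M"] by (auto simp: submodule_def)

lemma submodule_zero:
  assumes "submodule H R M" shows "\<zero>\<^bsub>M\<^esub> \<in> H"
  using assms subgroup.one_closed[of H "add_monoid M"] by (simp add: submodule_def)

lemma submodule_add:
  assumes "submodule H R M" "x \<in> H" "y \<in> H" shows "x \<oplus>\<^bsub>M\<^esub> y \<in> H"
  using assms subgroup.m_closed[of H "add_monoid M"] by (simp add: submodule_def)

lemma submodule_minus: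
  assumes "submodule H R M" "x \<in> H" shows "\<ominus>\<^bsub>M\<^esub> x \<in> H"
  using assms subgroup.m_inv_closed[of H "add_monoid M"] by (simp add: submodule_def a_inv_def)

lemma submodule_smult:
  assumes "submodule H R M" "a \<in> carrier R" "x \<in> H" shows "a \<odot>\<^bsub>M\<^esub> x \<in> H"
  using assms by (simp add: submodule_def submodule_axioms_def)

lemma submodule_additive_subgroup:
  "submodule H R M \<Longrightarrow> additive_subgroup H M"
  by (simp add: submodule_def additive_subgroup_def)

context left_module
begin

lemma submoduleI:
  assumes "H \<subseteq> carrier M" "\<zero>\<^bsub>M\<^esub> \<in> H" "\<And>x y. x \<in> H \<Longrightarrow> y \<in> H \<Longrightarrow> x \<oplus>\<^bsub>M\<^esub> y \<in> H"
    and "\<And>a x. a \<in> carrier R \<Longrightarrow> x \<in> H \<Longrightarrow> a \<odot>\<^bsub>M\<^esub> x \<in> H"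
  shows "submodule H R M"
proof -
  have "\<ominus>\<^bsub>M\<^esub> x \<in> H" if "x \<in> H" for x
  proof -
    have x: "x \<in> carrier M" using that assms(1) by auto
    have "(\<ominus> \<one>) \<odot>\<^bsub>M\<^esub> x \<oplus>\<^bsub>M\<^esub> \<one> \<odot>\<^bsub>M\<^esub> x = (\<ominus> \<one> \<oplus> \<one>) \<odot>\<^bsub>M\<^esub> x"
      using x by (simp only: smult_l_distr R.a_inv_closed R.one_closed)
    then have "(\<ominus> \<one>) \<odot>\<^bsub>M\<^esub> x = \<ominus>\<^bsub>M\<^esub> x"
      using x by (simp add: R.l_neg M.minus_equality)
    then show ?thesis using assms(4)[OF _ that, of "\<ominus> \<one>"] by simp
  qed
  then show ?thesis
    using assms by (intro submodule.intro submodule_axioms.intro subgroup.intro)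
      (auto simp flip: a_inv_def)
qed

lemma submodule_carrier: "submodule (carrier M) R M"
  by (intro submoduleI) auto

lemma submodule_singleton_zero: "submodule {\<zero>\<^bsub>M\<^esub>} R M"
  by (intro submoduleI) auto

lemma submodule_Inter:
  assumes "\<And>H. H \<in> \<H> \<Longrightarrow> submodule H R M" "\<H> \<noteq> {}"
  shows "submodule (\<Inter>\<H>) R M"
proof (rule submoduleI)
  show "\<Inter>\<H> \<subseteq> carrier M" using assms(2) submodule_mem[OF assms(1)] by auto
qed (auto intro: submodule_zero[OF assms(1)] submodule_add[OF assms(1)] submodule_smult[OF assms(1)])

lemma submodule_Union_chain:
  assumes sub: "\<And>H. H \<in> \<H> \<Longrightarrow> submodule H R M" and "\<H> \<noteq> {}"
    and chain: "\<And>H K. H \<in> \<H> \<Longrightarrow> K \<in> \<H> \<Longrightarrow> H \<subseteq> K \<or> K \<subseteq> H"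
  shows "submodule (\<Union>\<H>) R M"
proof (rule submoduleI)
  show "\<Union>\<H> \<subseteq> carrier M" using submodule_mem[OF sub] by (intro Union_least subsetI)
  show "\<zero>\<^bsub>M\<^esub> \<in> \<Union>\<H>" using assms(2) submodule_zero[OF sub] by auto
  show "a \<odot>\<^bsub>M\<^esub> x \<in> \<Union>\<H>" if "a \<in> carrier R" "x \<in> \<Union>\<H>" for a x
    using that submodule_smult[OF sub] by auto
next
  fix x y assume "x \<in> \<Union>\<H>" "y \<in> \<Union>\<H>"
  then obtain H K where HK: "H \<in> \<H>" "K \<in> \<H>" "x \<in> H" "y \<in> K" by blast
  then consider "x \<in> K" | "y \<in> H" using chain[of H K] by blast
  then show "x \<oplus>\<^bsub>M\<^esub> y \<in> \<Union>\<H>"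
    by cases (use HK submodule_add[OF sub] in blast)+
qed

context
  fixes H assumes H: "submodule H R M"
begin

interpretation H: abelian_subgroup H M
  by (rule abelian_subgroupI3[OF submodule_additive_subgroup[OF H] M.abelian_group_axioms])

lemma coset_eq_iff:
  assumes "x \<in> carrier M" "y \<in> carrier M"
  shows "H +>\<^bsub>M\<^esub> x = H +>\<^bsub>M\<^esub> y \<longleftrightarrow> x \<ominus>\<^bsub>M\<^esub> y \<in> H"
proof
  assume "H +>\<^bsub>M\<^esub> x = H +>\<^bsub>M\<^esub> y"
  then have "x \<in> H +>\<^bsub>M\<^esub> y" using H.a_rcos_self[OF assms(1)] by simp
  then show "x \<ominus>\<^bsub>M\<^esub> y \<in> H" using H.a_rcos_module_imp[OF assms(2)] by (simp add: a_minus_def)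
next
  assume "x \<ominus>\<^bsub>M\<^esub> y \<in> H"
  then have "x \<in> H +>\<^bsub>M\<^esub> y" using assms by (intro H.a_rcos_module_rev) (auto simp: a_minus_def)
  then show "H +>\<^bsub>M\<^esub> x = H +>\<^bsub>M\<^esub> y" using H.a_repr_independence'[OF _ assms(2)] by simp
qed

lemma coset_zero: "H +>\<^bsub>M\<^esub> \<zero>\<^bsub>M\<^esub> = H"
  using M.a_coset_add_zero H.a_subset by simp

lemma coset_eq_self_iff:
  assumes "x \<in> carrier M" shows "H +>\<^bsub>M\<^esub> x = H \<longleftrightarrow> x \<in> H"
  using coset_eq_iff[OF assms M.zero_closed] assms by (simp add: coset_zero a_minus_def a_inv_def)

lemma quot_carrier: "carrier (quot_module M H) = (\<lambda>x. H +>\<^bsub>M\<^esub> x) ` carrier M"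
  by (auto simp: quot_module_def A_RCOSETS_def')

lemma quot_zero [simp]: "\<zero>\<^bsub>quot_module M H\<^esub> = H"
  by (simp add: quot_module_def)

lemma quot_add:
  assumes "x \<in> carrier M" "y \<in> carrier M"
  shows "(H +>\<^bsub>M\<^esub> x) \<oplus>\<^bsub>quot_module M H\<^esub> (H +>\<^bsub>M\<^esub> y) = H +>\<^bsub>M\<^esub> (x \<oplus>\<^bsub>M\<^esub> y)"
  using assms by (simp add: quot_module_def H.a_rcos_sum)

lemma quot_smult:
  assumes "a \<in> carrier R" "x \<in> carrier M"
  shows "a \<odot>\<^bsub>quot_module M H\<^esub> (H +>\<^bsub>M\<^esub> x) = H +>\<^bsub>M\<^esub> (a \<odot>\<^bsub>M\<^esub> x)"
proof -
  have "H +>\<^bsub>M\<^esub> (a \<odot>\<^bsub>M\<^esub> y) = H +>\<^bsub>M\<^esub> (a \<odot>\<^bsub>M\<^esub> x)" if "y \<in> H +>\<^bsub>M\<^esub> x" for y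
  proof -
    obtain h where h: "h \<in> H" "y = h \<oplus>\<^bsub>M\<^esub> x" using \<open>y \<in> _\<close> by (auto simp: a_r_coset_def')
    have hM: "h \<in> carrier M" using submodule_mem[OF H h(1)] .
    have "a \<odot>\<^bsub>M\<^esub> y \<ominus>\<^bsub>M\<^esub> a \<odot>\<^bsub>M\<^esub> x = a \<odot>\<^bsub>M\<^esub> h"
      using h hM assms by (simp add: smult_r_distr a_minus_def M.a_assoc M.r_neg)
    then show ?thesis
      using h hM assms submodule_smult[OF H assms(1) h(1)] by (subst coset_eq_iff) auto
  qed
  moreover have "x \<in> H +>\<^bsub>M\<^esub> x" by (rule H.a_rcos_self[OF assms(2)])
  ultimately have "(\<Union>y\<in>H +>\<^bsub>M\<^esub> x. H +>\<^bsub>M\<^esub> (a \<odot>\<^bsub>M\<^esub> y)) = H +>\<^bsub>M\<^esub> (a \<odot>\<^bsub>M\<^esub> x)" by blast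
  then show ?thesis by (simp add: quot_module_def)
qed

lemma left_module_quot_module: "left_module R (quot_module M H)"
proof -
  have "abelian_group (quot_module M H)"
  proof (rule abelian_groupI)
    fix C assume "C \<in> carrier (quot_module M H)"
    then obtain x where x: "x \<in> carrier M" "C = H +>\<^bsub>M\<^esub> x" by (auto simp: quot_carrier)
    then have "(H +>\<^bsub>M\<^esub> (\<ominus>\<^bsub>M\<^esub> x)) \<oplus>\<^bsub>quot_module M H\<^esub> C = \<zero>\<^bsub>quot_module M H\<^esub>"
      by (simp add: quot_add M.l_neg coset_zero)
    then show "\<exists>D\<in>carrier (quot_module M H). D \<oplus>\<^bsub>quot_module M H\<^esub> C = \<zero>\<^bsub>quot_module M H\<^esub>"
      using x by (auto simp: quot_carrier)
    show "\<zero>\<^bsub>quot_module M H\<^esub> \<oplus>\<^bsub>quot_module M H\<^esub> C = C"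
      using quot_add[OF M.zero_closed x(1)] x by (simp add: coset_zero)
  next
    show "\<zero>\<^bsub>quot_module M H\<^esub> \<in> carrier (quot_module M H)"
      using coset_zero by (force simp: quot_carrier)
  qed (auto simp: quot_carrier quot_add M.a_ac)
  then show ?thesis
    by (intro left_module.intro R.ring_axioms left_module_axioms.intro)
      (auto simp: quot_carrier quot_add quot_smult smult_l_distr smult_r_distr smult_assoc1)
qed

lemma quot_proj_Hom: "(\<lambda>x\<in>carrier M. H +>\<^bsub>M\<^esub> x) \<in> Hom R M (quot_module M H)"
  by (auto simp: Hom_def quot_carrier quot_add quot_smult)

lemma submodule_quot_vimage:
  assumes Q: "submodule Q R (quot_module M H)"
  shows "submodule {x \<in> carrier M. H +>\<^bsub>M\<^esub> x \<in> Q} R M"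
  using submodule_zero[OF Q] submodule_add[OF Q] submodule_smult[OF Q]
  by (intro submoduleI) (auto simp: coset_zero simp flip: quot_add quot_smult)

end

lemma submodule_socle: "submodule (socle R \<S> M) R M"
proof -
  have "carrier M \<in> {H. submodule H R M \<and> (\<forall>B\<in>\<S>. \<forall>f\<in>Hom R B M. f ` carrier B \<subseteq> H)}"
    using submodule_carrier by (auto dest: HomD(1))
  then show ?thesis unfolding socle_def by (intro submodule_Inter) auto
qed

end

lemma Hom_into_socle:
  assumes "B \<in> \<S>" "f \<in> Hom R B N" "x \<in> carrier B"
  shows "f x \<in> socle R \<S> N"
  using assms unfolding socle_def by auto

lemma Hom_lift_along_surjection:
  assumes A: "left_module R A" and B: "left_module R B" and N: "left_module R N"
    and p: "p \<in> Hom R A B" "p ` carrier A = carrier B" and f: "f \<in> Hom R A N"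
    and ker: "ker A B p \<subseteq> ker A N f"
  shows "\<exists>g\<in>Hom R B N. \<forall>x\<in>carrier A. g (p x) = f x"
proof -
  interpret A: left_module R A by fact
  interpret B: left_module R B by fact
  interpret N: left_module R N by fact
  have eq: "f x = f y" if "x \<in> carrier A" "y \<in> carrier A" "p x = p y" for x y
  proof -
    have "x \<oplus>\<^bsub>A\<^esub> \<ominus>\<^bsub>A\<^esub> y \<in> ker A B p"
      using that HomD(1,2)[OF p(1)] by (auto simp: ker_def Hom_minus[OF A B p(1)] B.M.r_neg)
    then have "f (x \<oplus>\<^bsub>A\<^esub> \<ominus>\<^bsub>A\<^esub> y) = \<zero>\<^bsub>N\<^esub>" using ker by (auto simp: ker_def)
    then have "f x \<oplus>\<^bsub>N\<^esub> \<ominus>\<^bsub>N\<^esub> f y = \<zero>\<^bsub>N\<^esub>"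
      using that HomD(2)[OF f] by (simp add: Hom_minus[OF A N f])
    then show ?thesis
      using that HomD(1)[OF f] N.M.minus_equality[of "f x" "\<ominus>\<^bsub>N\<^esub> f y"] by simp
  qed
  define s where "s = inv_into (carrier A) p"
  have s: "s b \<in> carrier A" "p (s b) = b" if "b \<in> carrier B" for b
    using that p(2) by (auto simp: s_def inv_into_into f_inv_into_f)
  have gp: "f (s (p x)) = f x" if "x \<in> carrier A" for x
    using that s[of "p x"] HomD(1)[OF p(1)] by (intro eq) auto
  have "(\<lambda>b\<in>carrier B. f (s b)) \<in> Hom R B N"
    unfolding Hom_def
  proof (intro CollectI conjI ballI)
    fix x y assume xy: "x \<in> carrier B" "y \<in> carrier B"
    have "f (s (x \<oplus>\<^bsub>B\<^esub> y)) = f (s x \<oplus>\<^bsub>A\<^esub> s y)"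
      using xy s HomD(2)[OF p(1)] by (intro eq) auto
    then show "(\<lambda>b\<in>carrier B. f (s b)) (x \<oplus>\<^bsub>B\<^esub> y) =
        (\<lambda>b\<in>carrier B. f (s b)) x \<oplus>\<^bsub>N\<^esub> (\<lambda>b\<in>carrier B. f (s b)) y"
      using xy s HomD(2)[OF f] by simp
  next
    fix a x assume ax: "a \<in> carrier R" "x \<in> carrier B"
    have "f (s (a \<odot>\<^bsub>B\<^esub> x)) = f (a \<odot>\<^bsub>A\<^esub> s x)"
      using ax s HomD(3)[OF p(1)] by (intro eq) auto
    then show "(\<lambda>b\<in>carrier B. f (s b)) (a \<odot>\<^bsub>B\<^esub> x) = a \<odot>\<^bsub>N\<^esub> (\<lambda>b\<in>carrier B. f (s b)) x"
      using ax s HomD(3)[OF f] by simp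
  qed (use s HomD(1)[OF f] in auto)
  then show ?thesis
    using gp HomD(1)[OF p(1)] by (intro bexI) auto
qed


section \<open>The socle filtration\<close>

definition socle_preimage ::
    "('r, 'k) ring_scheme \<Rightarrow> ('r, 'x) module set \<Rightarrow> ('r, 'm) module \<Rightarrow> 'm set \<Rightarrow> 'm set"
  where "socle_preimage R \<S> M V = {x \<in> carrier M. V +>\<^bsub>M\<^esub> x \<in> socle R \<S> (quot_module M V)}"

lemma (in left_module) submodule_socle_preimage:
  assumes V: "submodule V R M" shows "submodule (socle_preimage R \<S> M V) R M"
  unfolding socle_preimage_def
  by (rule submodule_quot_vimage[OF V left_module.submodule_socle[OF left_module_quot_module[OF V]]])

lemma (in left_module) socle_preimage_superset:
  assumes V: "submodule V R M" shows "V \<subseteq> socle_preimage R \<S> M V"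
proof
  fix x assume "x \<in> V"
  then have "x \<in> carrier M" "V +>\<^bsub>M\<^esub> x = \<zero>\<^bsub>quot_module M V\<^esub>"
    using coset_eq_self_iff[OF V] submodule_mem[OF V] by (simp_all add: quot_zero[OF V])
  then show "x \<in> socle_preimage R \<S> M V"
    using submodule_zero[OF left_module.submodule_socle[OF left_module_quot_module[OF V]]]
    by (simp add: socle_preimage_def del: quot_zero)
qed

lemma socle_filtration_zero: "is_zero \<gamma> \<Longrightarrow> socle_filtration R \<S> M \<gamma> = {\<zero>\<^bsub>M\<^esub>}"
  by (simp add: socle_filtration.simps)

lemma socle_filtration_succ:
  assumes "is_succ \<kappa> \<gamma>"
  shows "socle_filtration R \<S> M \<gamma> = socle_preimage R \<S> M (socle_filtration R \<S> M \<kappa>)"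
proof -
  have "\<not> is_zero \<gamma>" using assms by (auto simp: is_zero_def is_succ_def not_le)
  then show ?thesis
    using assms is_succ_The[OF assms]
    by (subst socle_filtration.simps) (auto simp: Let_def socle_preimage_def)
qed

lemma socle_filtration_limit:
  "is_limit \<gamma> \<Longrightarrow> socle_filtration R \<S> M \<gamma> = (\<Union>\<kappa>\<in>{..<\<gamma>}. socle_filtration R \<S> M \<kappa>)"
  by (subst socle_filtration.simps) (simp add: is_limit_def)

lemma zero_succ_limit_cases [case_names zero succ limit]:
  obtains "is_zero \<gamma>" | \<kappa> where "is_succ \<kappa> \<gamma>" | "is_limit \<gamma>"
  by (auto simp: is_limit_def)

lemma (in left_module) socle_filtration_submodule_mono:
  fixes \<gamma> :: "'o::wellorder"
  shows "submodule (socle_filtration R \<S> M \<gamma>) R M \<and>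
    (\<forall>\<kappa>\<le>\<gamma>. socle_filtration R \<S> M \<kappa> \<subseteq> socle_filtration R \<S> M \<gamma>)"
proof (induction \<gamma> rule: less_induct)
  case (less \<gamma>)
  let ?V = "socle_filtration R \<S> M :: 'o \<Rightarrow> _"
  show ?case
  proof (cases rule: zero_succ_limit_cases[of \<gamma>])
    case zero
    then have "\<kappa> = \<gamma>" if "\<kappa> \<le> \<gamma>" for \<kappa> using that by (simp add: is_zero_def order_antisym)
    then have "?V \<kappa> \<subseteq> ?V \<gamma>" if "\<kappa> \<le> \<gamma>" for \<kappa> using that by blast
    then show ?thesis
      using submodule_singleton_zero by (simp only: socle_filtration_zero[OF zero]) blast
  next
    case (succ \<kappa>)
    then have \<kappa>: "\<kappa> < \<gamma>" "\<And>\<alpha>. \<alpha> < \<gamma> \<Longrightarrow> \<alpha> \<le> \<kappa>" by (auto simp: is_succ_def not_le not_less)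
    note IH = less.IH[OF \<kappa>(1)]
    have V: "?V \<kappa> \<subseteq> ?V \<gamma>"
      using socle_preimage_superset[OF conjunct1[OF IH]] by (simp only: socle_filtration_succ[OF succ])
    have "?V \<alpha> \<subseteq> ?V \<gamma>" if "\<alpha> \<le> \<gamma>" for \<alpha>
    proof (cases "\<alpha> = \<gamma>")
      case False
      then have "\<alpha> \<le> \<kappa>" using that \<kappa>(2) by simp
      then show ?thesis using IH V by blast
    qed simp
    then show ?thesis
      using submodule_socle_preimage[OF conjunct1[OF IH]] by (simp add: socle_filtration_succ[OF succ])
  next
    case limit
    have eq: "?V \<gamma> = \<Union>(?V ` {..<\<gamma>})" by (rule socle_filtration_limit[OF limit])
    have "submodule (\<Union>(?V ` {..<\<gamma>})) R M"
    proof (rule submodule_Union_chain)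
      show "?V ` {..<\<gamma>} \<noteq> {}"
        using limit by (auto simp: is_limit_def is_zero_def not_le)
      show "H \<subseteq> K \<or> K \<subseteq> H" if HK: "H \<in> ?V ` {..<\<gamma>}" "K \<in> ?V ` {..<\<gamma>}" for H K
      proof -
        obtain \<alpha> \<beta> where ab: "\<alpha> < \<gamma>" "\<beta> < \<gamma>" "H = ?V \<alpha>" "K = ?V \<beta>" using HK by auto
        then show ?thesis using less.IH linear[of \<alpha> \<beta>] by blast
      qed
    qed (use less.IH in auto)
    moreover have "?V \<alpha> \<subseteq> ?V \<gamma>" if "\<alpha> \<le> \<gamma>" for \<alpha>
      using that unfolding order.order_iff_strict by (auto simp: eq)
    ultimately show ?thesis by (simp add: eq)
  qed
qed

lemmas (in left_module) submodule_socle_filtration =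
  socle_filtration_submodule_mono[THEN conjunct1]
lemmas (in left_module) socle_filtration_mono =
  socle_filtration_submodule_mono[THEN conjunct2, rule_format]

lemma (in left_module) socle_filtration_chain:
  fixes \<kappa> \<gamma> :: "'o::wellorder"
  shows "socle_filtration R \<S> M \<kappa> \<subseteq> socle_filtration R \<S> M \<gamma> \<or>
    socle_filtration R \<S> M \<gamma> \<subseteq> socle_filtration R \<S> M \<kappa>"
  by (meson linear socle_filtration_mono)

lemma finite_subset_of_directed_Union:
  assumes "finite X" "X \<subseteq> \<Union>\<W>" "\<W> \<noteq> {}"
    and dir: "\<And>V W. V \<in> \<W> \<Longrightarrow> W \<in> \<W> \<Longrightarrow> \<exists>U\<in>\<W>. V \<subseteq> U \<and> W \<subseteq> U"
  shows "\<exists>W\<in>\<W>. X \<subseteq> W"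
  using assms(1,2)
proof (induction X)
  case empty
  then show ?case using \<open>\<W> \<noteq> {}\<close> by auto
next
  case (insert x X)
  then obtain V W where "V \<in> \<W>" "W \<in> \<W>" "X \<subseteq> V" "x \<in> W" by auto
  then show ?case using dir[of V W] by (metis insert_subset subset_iff)
qed

lemma (in left_module) finitely_presented_extension:
  fixes B :: "('r, 'x) module"
  assumes B: "B \<in> \<S>" "left_module R B" "finitely_presented R B"
    and G: "submodule G R M" and G': "submodule G' R M" and "G \<subseteq> G'"
    and iso: "module_iso R (quot_module (restrict_module M G') G) B"
    and \<W>: "\<W> \<noteq> {}" "\<And>W. W \<in> \<W> \<Longrightarrow> submodule W R M"
      "\<And>V W. V \<in> \<W> \<Longrightarrow> W \<in> \<W> \<Longrightarrow> \<exists>U\<in>\<W>. V \<subseteq> U \<and> W \<subseteq> U"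
    and "G \<subseteq> \<Union>\<W>"
  shows "\<exists>W\<in>\<W>. \<forall>z\<in>G'. \<exists>x\<in>G. \<exists>y\<in>socle_preimage R \<S> M W. z = x \<oplus>\<^bsub>M\<^esub> y"
proof -
  let ?N = "restrict_module M G'"
  have N: "left_module R ?N" by (rule submodule_left_module[OF G'])
  interpret N: left_module R ?N by fact
  interpret B: left_module R B by fact
  have Nc: "carrier ?N = G'" and Nops: "x \<oplus>\<^bsub>?N\<^esub> y = x \<oplus>\<^bsub>M\<^esub> y" "a \<odot>\<^bsub>?N\<^esub> x = a \<odot>\<^bsub>M\<^esub> x"
    for x y a by (simp_all add: restrict_module_def)
  have GN: "submodule G R ?N"
    using \<open>G \<subseteq> G'\<close> submodule_zero[OF G] submodule_add[OF G] submodule_smult[OF G]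
    by (intro N.submoduleI) (auto simp: restrict_module_def)
  obtain \<theta> where \<theta>: "\<theta> \<in> Hom R (quot_module ?N G) B"
    "bij_betw \<theta> (carrier (quot_module ?N G)) (carrier B)"
    using iso by (auto simp: module_iso_def)
  define \<pi> where "\<pi> = compose (carrier ?N) \<theta> (\<lambda>x\<in>carrier ?N. G +>\<^bsub>?N\<^esub> x)"
  have \<pi>: "\<pi> \<in> Hom R ?N B"
    unfolding \<pi>_def by (rule Hom_compose[OF N N.quot_proj_Hom[OF GN] \<theta>(1)])
  have \<pi>_surj: "\<pi> ` carrier ?N = carrier B"
    using bij_betw_imp_surj_on[OF \<theta>(2)]
    by (auto simp: \<pi>_def compose_def N.quot_carrier[OF GN] image_image)
  have \<pi>_ker: "x \<in> G" if "x \<in> G'" "\<pi> x = \<zero>\<^bsub>B\<^esub>" for x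
  proof -
    have QN: "left_module R (quot_module ?N G)" by (rule N.left_module_quot_module[OF GN])
    interpret QN: left_module R "quot_module ?N G" by (rule QN)
    have "\<theta> (G +>\<^bsub>?N\<^esub> x) = \<theta> \<zero>\<^bsub>quot_module ?N G\<^esub>"
      using that Hom_zero[OF QN B(2) \<theta>(1)] by (simp add: \<pi>_def compose_def Nc)
    then have "G +>\<^bsub>?N\<^esub> x = G"
      using inj_onD[OF bij_betw_imp_inj_on[OF \<theta>(2)]] that QN.M.zero_closed
      by (auto simp: N.quot_carrier[OF GN] Nc N.quot_zero[OF GN])
    then show ?thesis using N.coset_eq_self_iff[OF GN] that Nc by simp
  qed
  obtain m n :: nat and d p where
    d: "d \<in> Hom R (free_module R {..<m}) (free_module R {..<n})" and
    p: "p \<in> Hom R (free_module R {..<n}) B" and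
    exact: "d ` carrier (free_module R {..<m}) = ker (free_module R {..<n}) B p" and
    p_surj: "p ` carrier (free_module R {..<n}) = carrier B"
    using B(3) by (auto simp: finitely_presented_def)
  let ?Fm = "free_module R {..<m}" and ?Fn = "free_module R {..<n}"
  have Fm: "left_module R ?Fm" and Fn: "left_module R ?Fn"
    by (rule left_module_free_module, rule R.ring_axioms)+
  interpret Fm: left_module R ?Fm by fact
  note unit = unit_vec_closed[OF R.ring_axioms, of "{..<m}"]
  obtain h where hN: "h \<in> Hom R ?Fn ?N" and \<pi>h: "compose (carrier ?Fn) \<pi> h = p"
    using free_module_lift[OF N B(2) \<pi> \<pi>_surj p] by blast
  have \<pi>h: "\<pi> (h x) = p x" if "x \<in> carrier ?Fn" for x
    using fun_cong[OF \<pi>h, of x] that by (simp add: compose_def)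
  have hG': "h x \<in> G'" if "x \<in> carrier ?Fn" for x
    using HomD(1)[OF hN that] Nc by simp
  have h: "h \<in> Hom R ?Fn M"
    using hN submodule_mem[OF G'] by (auto simp: Hom_def Nops Nc)
  have hd: "h (d x) \<in> G" if "x \<in> carrier ?Fm" for x
  proof -
    have "d x \<in> carrier ?Fn" "p (d x) = \<zero>\<^bsub>B\<^esub>" using that exact by (auto simp: ker_def)
    then show ?thesis using \<pi>_ker \<pi>h hG' by simp
  qed
  obtain W where W: "W \<in> \<W>" "(\<lambda>i. h (d (unit_vec R {..<m} i))) ` {..<m} \<subseteq> W"
    using finite_subset_of_directed_Union[OF _ _ \<W>(1,3), of "(\<lambda>i. h (d (unit_vec R {..<m} i))) ` {..<m}"]
      hd unit \<open>G \<subseteq> \<Union>\<W>\<close> by blast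
  have sW: "submodule W R M" by (rule \<W>(2)[OF W(1)])
  have Q: "left_module R (quot_module M W)" by (rule left_module_quot_module[OF sW])
  interpret Q: left_module R "quot_module M W" by fact
  let ?f = "compose (carrier ?Fn) (\<lambda>x\<in>carrier M. W +>\<^bsub>M\<^esub> x) h"
  have f: "?f \<in> Hom R ?Fn (quot_module M W)"
    by (rule Hom_compose[OF Fn h quot_proj_Hom[OF sW]])
  have f_eq: "?f x = W +>\<^bsub>M\<^esub> h x" if "x \<in> carrier ?Fn" for x
    using that HomD(1)[OF h] by (simp add: compose_def)
  have "compose (carrier ?Fm) ?f d = zero_map ?Fm (quot_module M W)"
  proof (rule free_module_Hom_eqI[OF Q Hom_compose[OF Fm d f]])
    show "zero_map ?Fm (quot_module M W) \<in> Hom R ?Fm (quot_module M W)"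
      by (auto simp: zero_map_def Hom_def simp del: quot_zero)
    fix i assume "i \<in> {..<m}"
    then have "h (d (unit_vec R {..<m} i)) \<in> W" using W(2) by auto
    then show "compose (carrier ?Fm) ?f d (unit_vec R {..<m} i) =
        zero_map ?Fm (quot_module M W) (unit_vec R {..<m} i)"
      using unit[of i] HomD(1)[OF d unit[of i]] coset_eq_self_iff[OF sW] submodule_mem[OF sW] f_eq
      by (simp add: zero_map_def compose_eq quot_zero[OF sW])
  qed
  then have fd: "?f (d x) = \<zero>\<^bsub>quot_module M W\<^esub>" if "x \<in> carrier ?Fm" for x
    using that by (auto simp: zero_map_def compose_eq dest: fun_cong[of _ _ x])
  have "ker ?Fn B p \<subseteq> ker ?Fn (quot_module M W) ?f"
    unfolding exact[symmetric] using fd HomD(1)[OF d] by (auto simp: ker_def)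
  then obtain g where g: "g \<in> Hom R B (quot_module M W)" "\<And>x. x \<in> carrier ?Fn \<Longrightarrow> g (p x) = ?f x"
    using Hom_lift_along_surjection[OF Fn B(2) Q p p_surj f] by blast
  have h_socle: "h x \<in> socle_preimage R \<S> M W" if "x \<in> carrier ?Fn" for x
    using Hom_into_socle[OF B(1) g(1) HomD(1)[OF p that]] that f_eq g(2) HomD(1)[OF h]
    by (simp add: socle_preimage_def)
  have "\<exists>x\<in>G. \<exists>y\<in>socle_preimage R \<S> M W. z = x \<oplus>\<^bsub>M\<^esub> y" if z: "z \<in> G'" for z
  proof -
    obtain x where x: "x \<in> carrier ?Fn" "p x = \<pi> z"
      using p_surj HomD(1)[OF \<pi>] z Nc by (metis imageE)
    have hM: "h x \<in> carrier M" "z \<in> carrier M" using x z HomD(1)[OF h] submodule_mem[OF G'] by auto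
    have "\<ominus>\<^bsub>M\<^esub> h x \<in> G'" using submodule_minus[OF G' hG'[OF x(1)]] .
    moreover have "z \<oplus>\<^bsub>M\<^esub> \<ominus>\<^bsub>M\<^esub> h x \<in> G"
    proof (rule \<pi>_ker)
      show "z \<oplus>\<^bsub>M\<^esub> \<ominus>\<^bsub>M\<^esub> h x \<in> G'" using submodule_add[OF G' z] calculation .
      have "\<pi> z = \<pi> ((z \<oplus>\<^bsub>M\<^esub> \<ominus>\<^bsub>M\<^esub> h x) \<oplus>\<^bsub>M\<^esub> h x)"
        using hM by (simp add: M.a_assoc M.l_neg)
      also have "\<dots> = \<pi> (z \<oplus>\<^bsub>M\<^esub> \<ominus>\<^bsub>M\<^esub> h x) \<oplus>\<^bsub>B\<^esub> \<pi> (h x)"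
        using HomD(2)[OF \<pi>, of "z \<oplus>\<^bsub>M\<^esub> \<ominus>\<^bsub>M\<^esub> h x" "h x"] Nc Nops hG'[OF x(1)]
          \<open>z \<oplus>\<^bsub>M\<^esub> \<ominus>\<^bsub>M\<^esub> h x \<in> G'\<close> by simp
      finally have "\<pi> z = \<pi> (z \<oplus>\<^bsub>M\<^esub> \<ominus>\<^bsub>M\<^esub> h x) \<oplus>\<^bsub>B\<^esub> \<pi> z" using \<pi>h x by simp
      then show "\<pi> (z \<oplus>\<^bsub>M\<^esub> \<ominus>\<^bsub>M\<^esub> h x) = \<zero>\<^bsub>B\<^esub>"
        using HomD(1)[OF \<pi>] z Nc \<open>z \<oplus>\<^bsub>M\<^esub> \<ominus>\<^bsub>M\<^esub> h x \<in> G'\<close> B.M.add.r_cancel_one'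
        by simp
    qed
    moreover have "z = (z \<oplus>\<^bsub>M\<^esub> \<ominus>\<^bsub>M\<^esub> h x) \<oplus>\<^bsub>M\<^esub> h x" using hM by (simp add: M.a_assoc M.l_neg)
    ultimately show ?thesis using h_socle[OF x(1)] by blast
  qed
  then show ?thesis using W(1) by blast
qed

lemma (in left_module) filtration_le_finite_socle_layers:
  fixes \<mu> :: "'o::wellorder"
  assumes fp: "\<And>B. B \<in> \<S> \<Longrightarrow> left_module R B \<and> finitely_presented R B"
    and F: "S_filtration R \<S> M \<mu> F" and "\<gamma> \<le> \<mu>"
  shows "F \<gamma> \<subseteq> (\<Union>\<kappa>\<in>{\<kappa>. \<kappa> \<le> \<gamma> \<and> finite {..<\<kappa>}}. socle_filtration R \<S> M \<kappa>)"
  using \<open>\<gamma> \<le> \<mu>\<close>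
proof (induction \<gamma> rule: less_induct)
  case (less \<gamma>)
  let ?V = "socle_filtration R \<S> M :: 'o \<Rightarrow> _"
  have fil: "filtration R M \<mu> F" using F by (simp add: S_filtration_def)
  show ?case
  proof (cases rule: zero_succ_limit_cases[of \<gamma>])
    case zero
    then have "F \<gamma> = {\<zero>\<^bsub>M\<^esub>}" "{..<\<gamma>} = {}"
      using fil by (auto simp: filtration_def is_zero_def dest: leD)
    then show ?thesis using submodule_zero[OF submodule_socle_filtration] by force
  next
    case limit
    then have "F \<gamma> = (\<Union>\<kappa>\<in>{..<\<gamma>}. F \<kappa>)" using fil less.prems by (simp add: filtration_def)
    show ?thesis
    proof
      fix x assume "x \<in> F \<gamma>"
      then obtain \<alpha> where \<alpha>: "\<alpha> < \<gamma>" "x \<in> F \<alpha>" using \<open>F \<gamma> = _\<close> by auto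
      then obtain \<kappa> where "\<kappa> \<le> \<alpha>" "finite {..<\<kappa>}" "x \<in> ?V \<kappa>"
        using less.IH[of \<alpha>] less.prems order.trans[OF less_imp_le] by blast
      then show "x \<in> \<Union>(?V ` {\<kappa>. \<kappa> \<le> \<gamma> \<and> finite {..<\<kappa>}})" using \<alpha>(1) order.trans[OF _ less_imp_le] by blast
    qed
  next
    case (succ \<delta>)
    then have \<delta>: "\<delta> < \<gamma>" "\<And>\<alpha>. \<delta> < \<alpha> \<Longrightarrow> \<gamma> \<le> \<alpha>" by (auto simp: is_succ_def)
    let ?W = "?V ` {\<kappa>. \<kappa> \<le> \<delta> \<and> finite {..<\<kappa>}}"
    let ?U = "\<Union>(?V ` {\<kappa>. \<kappa> \<le> \<gamma> \<and> finite {..<\<kappa>}})"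
    obtain B where B: "B \<in> \<S>" "module_iso R (quot_module (restrict_module M (F \<gamma>)) (F \<delta>)) B"
      using F succ order.strict_trans2[OF \<delta>(1) less.prems] by (auto simp: S_filtration_def)
    have sub: "submodule (F \<delta>) R M" "submodule (F \<gamma>) R M" "F \<delta> \<subseteq> F \<gamma>"
      using fil \<delta>(1) less.prems by (auto simp: filtration_def)
    have IH: "F \<delta> \<subseteq> \<Union>?W" using less.IH[OF \<delta>(1)] \<delta>(1) less.prems by simp
    then have ne: "?W \<noteq> {}" using submodule_zero[OF sub(1)] by auto
    have "\<exists>U\<in>?W. V \<subseteq> U \<and> W \<subseteq> U" if VW: "V \<in> ?W" "W \<in> ?W" for V W
    proof -
      have "V \<subseteq> W \<or> W \<subseteq> V" using VW socle_filtration_chain by blast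
      then show ?thesis using VW by (meson order_refl)
    qed
    then have "\<exists>W\<in>?W. \<forall>z\<in>F \<gamma>. \<exists>x\<in>F \<delta>. \<exists>y\<in>socle_preimage R \<S> M W. z = x \<oplus>\<^bsub>M\<^esub> y"
      using fp[OF B(1)] submodule_socle_filtration
      by (intro finitely_presented_extension[OF B(1) _ _ sub B(2) ne _ _ IH]) auto
    then obtain W where W: "W \<in> ?W"
      "\<And>z. z \<in> F \<gamma> \<Longrightarrow> \<exists>x\<in>F \<delta>. \<exists>y\<in>socle_preimage R \<S> M W. z = x \<oplus>\<^bsub>M\<^esub> y"
      by blast
    obtain \<kappa> where \<kappa>: "\<kappa> \<le> \<delta>" "finite {..<\<kappa>}" "W = ?V \<kappa>" using W(1) by auto
    define \<kappa>' where "\<kappa>' = (LEAST \<alpha>. \<kappa> < \<alpha>)"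
    have lt: "\<kappa> < \<gamma>" using \<kappa>(1) \<delta>(1) by simp
    have \<kappa>': "is_succ \<kappa> \<kappa>'" "\<kappa>' \<le> \<gamma>"
      unfolding is_succ_def \<kappa>'_def using LeastI[of "\<lambda>\<alpha>. \<kappa> < \<alpha>", OF lt] Least_le[of "\<lambda>\<alpha>. \<kappa> < \<alpha>"] lt
      by auto
    have "{..<\<kappa>'} \<subseteq> insert \<kappa> {..<\<kappa>}" using \<kappa>'(1) by (auto simp: is_succ_def) (metis leD linorder_neqE)
    then have "finite {..<\<kappa>'}" using \<kappa>(2) by (simp add: finite_subset)
    then have pre: "socle_preimage R \<S> M W \<subseteq> ?U"
      using \<kappa>' by (auto simp: \<kappa>(3) simp flip: socle_filtration_succ[OF \<kappa>'(1)])
    have U: "submodule ?U R M"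
    proof (rule submodule_Union_chain)
      show "?V ` {\<kappa>. \<kappa> \<le> \<gamma> \<and> finite {..<\<kappa>}} \<noteq> {}" using \<kappa>(2) less_imp_le[OF lt] by blast
      show "H \<subseteq> K \<or> K \<subseteq> H" if "H \<in> ?V ` {\<kappa>. \<kappa> \<le> \<gamma> \<and> finite {..<\<kappa>}}"
        "K \<in> ?V ` {\<kappa>. \<kappa> \<le> \<gamma> \<and> finite {..<\<kappa>}}" for H K
        using that socle_filtration_chain by blast
    qed (use submodule_socle_filtration in auto)
    have F\<delta>: "F \<delta> \<subseteq> ?U"
      by (rule order.trans[OF IH Union_mono[OF image_mono]]) (use \<delta>(1) in auto)
    show ?thesis
    proof
      fix z assume "z \<in> F \<gamma>"
      then obtain x y where "x \<in> F \<delta>" "y \<in> socle_preimage R \<S> M W" "z = x \<oplus>\<^bsub>M\<^esub> y"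
        using W(2) by blast
      then show "z \<in> ?U" using submodule_add[OF U] subsetD[OF F\<delta>] subsetD[OF pre] by simp
    qed
  qed
qed

lemma countable_lessThan_if_finite_segments:
  fixes \<nu> :: "'o::wellorder"
  assumes "\<And>\<kappa>. \<kappa> < \<nu> \<Longrightarrow> finite {..<\<kappa>}"
  shows "countable {..<\<nu>}"
proof (rule countableI)
  show "inj_on (\<lambda>\<kappa>. card {..<\<kappa>}) {..<\<nu>}"
  proof (rule linorder_inj_onI')
    fix \<kappa> \<gamma> assume "\<kappa> \<in> {..<\<nu>}" "\<gamma> \<in> {..<\<nu>}" "\<kappa> < \<gamma>"
    then have "card {..<\<kappa>} < card {..<\<gamma>}" using assms by (intro psubset_card_mono) auto
    then show "card {..<\<kappa>} \<noteq> card {..<\<gamma>}" by simp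
  qed
qed

theorem corollary6p6:
  fixes R :: "'r ring"
    and \<S> :: "('r, 'x) module set"
    and M :: "('r, 'm) module"
  assumes "ring R"
    and "semibrick R \<S>"
    and "\<forall>B\<in>\<S>. proj_dim_le_1 R B"
    and "\<forall>B\<in>\<S>. \<not> divisible R \<S> B"
    and "M \<in> Filt TYPE('o::wellorder) R \<S>"
  shows "\<exists>\<nu>::'o. socle_length R \<S> M \<nu> \<and> countable {..<\<nu>}"
proof -
  obtain \<mu> :: 'o and F where M: "left_module R M" and F: "S_filtration R \<S> M \<mu> F"
    using assms(5) by (auto simp: Filt_def)
  interpret left_module R M by fact
  let ?V = "socle_filtration R \<S> M :: 'o \<Rightarrow> _"
  have "left_module R B \<and> finitely_presented R B" if "B \<in> \<S>" for B
    using assms(2) that by (simp add: semibrick_def brick_def)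
  from filtration_le_finite_socle_layers[OF this F order_refl]
  have fin: "carrier M \<subseteq> (\<Union>\<kappa>\<in>{\<kappa>. \<kappa> \<le> \<mu> \<and> finite {..<\<kappa>}}. ?V \<kappa>)"
    using F by (simp add: S_filtration_def filtration_def)
  have V_sub: "?V \<gamma> \<subseteq> carrier M" for \<gamma> using submodule_mem[OF submodule_socle_filtration] by auto
  \<comment> \<open>\<open>\<omega>\<close> is the first infinite ordinal, or \<open>\<mu>\<close> if there is none up to \<open>\<mu>\<close>\<close>
  define \<omega> where "\<omega> = (LEAST \<alpha>. \<alpha> = \<mu> \<or> infinite {..<\<alpha>})"
  have \<omega>: "\<omega> = \<mu> \<or> infinite {..<\<omega>}" "\<omega> \<le> \<mu>"
    unfolding \<omega>_def by (rule LeastI[of _ \<mu>], simp) (rule Least_le, simp)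
  have below: "finite {..<\<kappa>}" if "\<kappa> < \<omega>" for \<kappa>
    using not_less_Least[OF that[unfolded \<omega>_def]] by blast
  have "?V \<omega> = carrier M"
  proof
    show "carrier M \<subseteq> ?V \<omega>"
    proof
      fix x assume "x \<in> carrier M"
      then obtain \<kappa> where \<kappa>: "\<kappa> \<le> \<mu>" "finite {..<\<kappa>}" "x \<in> ?V \<kappa>" using fin by blast
      have "\<kappa> \<le> \<omega>"
      proof (rule ccontr)
        assume "\<not> \<kappa> \<le> \<omega>"
        then have "\<omega> < \<kappa>" "infinite {..<\<omega>}" using \<omega> \<kappa>(1) by auto
        then show False using \<kappa>(2) finite_subset[of "{..<\<omega>}" "{..<\<kappa>}"] by auto
      qed
      then show "x \<in> ?V \<omega>" using socle_filtration_mono \<kappa>(3) by blast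
    qed
  qed (rule V_sub)
  define \<nu> where "\<nu> = (LEAST \<alpha>. ?V \<alpha> = carrier M)"
  have "socle_length R \<S> M \<nu>"
    unfolding socle_length_def \<nu>_def
    using LeastI[of "\<lambda>\<alpha>. ?V \<alpha> = carrier M", OF \<open>?V \<omega> = carrier M\<close>] not_less_Least by blast
  moreover have "\<nu> \<le> \<omega>" unfolding \<nu>_def by (rule Least_le) fact
  then have "countable {..<\<nu>}" using below by (intro countable_lessThan_if_finite_segments) auto
  ultimately show ?thesis by blast
qed

end
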